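(* Let $(X,e)$ be a coalgebra $e:X\to M\otimes X$ for $F=M\otimes -$ on the category $\mathbf{Set}_3$ of tri-pointed sets. Let $(S,\psi)$ be the $F$-coalgebra obtained by Cauchy completing the initial algebra $(G,g)$ of $F$ on $\mathbf{Set}_3$, and for $x\in X$ let $(\theta_k(x))_{k}$ be the associated Cauchy sequence in $G\subseteq S$. Then the function $f:X\to S$ given by $f(x)=\lim_{k\to\infty}\theta_k(x)$ is a morphism in $\mathbf{Set}_3$ and satisfies $(M\otimes f)\circ e=\psi\circ f$. Moreover, it is the only morphism $f:X\to S$ in $\mathbf{Set}_3$ satisfying $(M\otimes f)\circ e=\psi\circ f$.
   Context: A tri-pointed set is a set $X$ with three distinguished elements $T,L,R$ (written $T_X,L_X,R_X$). $\mathbf{Set}_3$ is the category of tri-pointed sets and functions preserving $T,L,R$. A tri-pointed metric space is a tri-pointed set with a metric $d$ satisfying $d(x,y)\le 1$ for all $x,y$ and such that any two different ones of the distinguished elements are at distance exactly $1$. Let $M=\{a,b,c\}$. For a tri-pointed set $X$, $M\otimes X$ is the quotient of $M\times X$ by the equivalence relation generated by $(b,T)\sim(a,L)$, $(a,R)\sim(c,T)$, $(c,L)\sim(b,R)$; the class of $(m,x)$ is written $m\otimes x$. Its distinguished elements are $T_{M\otimes X}=a\otimes T$, $L_{M\otimes X}=b\otimes L$, $R_{M\otimes X}=c\otimes R$. If $X$ is a tri-pointed metric space, $M\times X$ has the metric $d((m,x),(n,y))=\frac12 d(x,y)$ if $m=n$ and $1$ if $m\ne n$, and $M\otimes X$ has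 the quotient metric, which is explicitly: $d(m\otimes x,m\otimes y)=\frac12 d(x,y)$; $d(a\otimes x,b\otimes y)=\frac12\min\{d(x,L)+d(T,y),\,d(x,R)+1+d(R,y)\}$; $d(a\otimes x,c\otimes y)=\frac12\min\{d(x,R)+d(T,y),\,d(x,L)+1+d(L,y)\}$; $d(b\otimes x,c\otimes y)=\frac12\min\{d(x,R)+d(L,y),\,d(x,T)+1+d(T,y)\}$. This is again a tri-pointed metric space. The functor $F=M\otimes -$ acts on morphisms by $(M\otimes f)(m\otimes x)=m\otimes f(x)$; $M^n\otimes -$ is its $n$-fold iterate, with elements $m_1\otimes\cdots\otimes m_n\otimes x$. Let $I=\{T,L,R\}$ with the discrete metric, and $!:I\to M\otimes I$ the map $T\mapsto a\otimes T$, $L\mapsto b\otimes L$, $R\mapsto c\otimes R$. $G$ is the colimit of $I\xrightarrow{!}M\otimes I\xrightarrow{M\otimes !}M^2\otimes I\to\cdots$, i.e. the quotient of the disjoint union of the $M^n\otimes I$ identifying each element with its images along the chain; $[\chi]$ is the class of $\chi$. Distinguished points of $G$: $[T],[L],[R]$. All chain maps are isometric embeddings, and the canonical metric of $G$ is $d_G([\chi],[\chi'])=d(\tilde\chi,\tilde\chi')$, where $\tilde\chi,\tilde\chi'$ are images of $\chi,\chi'$ in a common $M^p\otimes I$. The map $g:M\otimes G\to G$, $g(m\otimes[x])=[m\otimes x]$, is an isometric isomorphism and $(G,g)$ is the initial $F$-algebra on $\mathbf{Set}_3$. $S$ is the Cauchy completion of $G$ (equivalence classes $[x_n]$ of Cauchy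 sequences $(x_n)$ in $G$), with distinguished points those of $G$; $s:M\otimes S\to S$ is the isometric isomorphism $s(m\otimes[x_n])=[g(m\otimes x_n)]$, and $\psi=s^{-1}$. $G$ is regarded as a dense subset of $S$. The sequence $\theta_n(x)$: given a coalgebra $e:X\to M\otimes X$ in $\mathbf{Set}_3$ and $x\in X$, choose inductively $x_0=x$ and, for $n\ge1$, $m_n\in M$ and $x_n\in X$ with $e(x_{n-1})=m_n\otimes x_n$. Put $\theta_n(x)=[m_1\otimes\cdots\otimes m_n\otimes\overline{x_n}]\in G$, where $\overline{x_n}\in I$ is $T$, $L$ or $R$ according as $m_n$ is $a$, $b$ or $c$. The sequence $(\theta_n(x))_n$ is Cauchy in $G$. The representatives may be chosen arbitrarily for each $x$. *)

theory Defs
  imports "HOL-Analysis.Analysis" "HOL-Library.FSet"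
begin

section \<open>Tri-pointed sets and the category they form\<close>

record 'a tri =
  pts :: "'a set"
  ptT :: 'a
  ptL :: 'a
  ptR :: 'a

text \<open>
  The metric is a field of the structure; as a function on the ambient type it is only
  meaningful on the carrier.
\<close>

record 'a mtri = "'a tri" +
  dst :: "'a \<Rightarrow> 'a \<Rightarrow> real"

text \<open>The distinguished elements are pairwise different; there is no morphism into the
  completion \<open>S3\<close> below otherwise.\<close>

definition tri_pointed :: "('a, 'z) tri_scheme \<Rightarrow> bool" where
  "tri_pointed X \<longleftrightarrow>
     ptT X \<in> pts X \<and> ptL X \<in> pts X \<and> ptR X \<in> pts X \<and>
     ptT X \<noteq> ptL X \<and> ptT X \<noteq> ptR X \<and> ptL X \<noteq> ptR X"

text \<open>
  The locale \<open>Metric_space\<close> wants symmetry and nonnegativity on the whole type, hence the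
  extension by \<open>0\<close> off the carrier.
\<close>

definition dst_on :: "'a mtri \<Rightarrow> 'a \<Rightarrow> 'a \<Rightarrow> real" where
  "dst_on X x y = (if x \<in> pts X \<and> y \<in> pts X then dst X x y else 0)"

definition tri_metric :: "'a mtri \<Rightarrow> bool" where
  "tri_metric X \<longleftrightarrow>
     tri_pointed X \<and> Metric_space (pts X) (dst_on X) \<and>
     (\<forall>x\<in>pts X. \<forall>y\<in>pts X. dst X x y \<le> 1) \<and>
     dst X (ptT X) (ptL X) = 1 \<and> dst X (ptT X) (ptR X) = 1 \<and> dst X (ptL X) (ptR X) = 1"

text \<open>Morphisms are total functions of which only the values on the carrier matter.\<close>

definition morphism3 ::
  "('a, 'y) tri_scheme \<Rightarrow> ('b, 'z) tri_scheme \<Rightarrow> ('a \<Rightarrow> 'b) \<Rightarrow> bool" where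
  "morphism3 X Y f \<longleftrightarrow>
     f \<in> pts X \<rightarrow> pts Y \<and> f (ptT X) = ptT Y \<and> f (ptL X) = ptL Y \<and> f (ptR X) = ptR Y"

definition equiv_gen :: "'a set \<Rightarrow> ('a \<Rightarrow> 'a \<Rightarrow> bool) \<Rightarrow> 'a rel" where
  "equiv_gen A r = {(p, q). p \<in> A \<and> q \<in> A \<and> equivclp r p q}"

lemma equiv_equiv_gen: "equiv A (equiv_gen A r)"
  by (rule equivI)
     (auto simp: equiv_gen_def refl_on_def intro!: symI transI
           intro: equivclp_sym equivclp_trans)


section \<open>The functor \<open>M \<otimes> -\<close>\<close>

datatype tag = M_a | M_b | M_c

inductive glue :: "('a, 'z) tri_scheme \<Rightarrow> tag \<times> 'a \<Rightarrow> tag \<times> 'a \<Rightarrow> bool"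
  for X :: "('a, 'z) tri_scheme" where
  "glue X (M_b, ptT X) (M_a, ptL X)"
| "glue X (M_a, ptR X) (M_c, ptT X)"
| "glue X (M_c, ptL X) (M_b, ptR X)"

definition tens_rel :: "('a, 'z) tri_scheme \<Rightarrow> (tag \<times> 'a) rel" where
  "tens_rel X = equiv_gen (UNIV \<times> pts X) (glue X)"

definition tens :: "('a, 'z) tri_scheme \<Rightarrow> tag \<Rightarrow> 'a \<Rightarrow> (tag \<times> 'a) set" where
  "tens X m x = tens_rel X `` {(m, x)}"

definition Tens :: "('a, 'z) tri_scheme \<Rightarrow> (tag \<times> 'a) set tri" where
  "Tens X =
     \<lparr>pts = (UNIV \<times> pts X) // tens_rel X,
      ptT = tens X M_a (ptT X), ptL = tens X M_b (ptL X), ptR = tens X M_c (ptR X)\<rparr>"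

text \<open>
  The action on a morphism \<open>f\<close> with codomain \<open>Y\<close>. For a class \<open>p\<close> all sets in the union are
  the same class \<open>m \<otimes> f x\<close>.
\<close>

definition Tens_map ::
  "('b, 'z) tri_scheme \<Rightarrow> ('a \<Rightarrow> 'b) \<Rightarrow> (tag \<times> 'a) set \<Rightarrow> (tag \<times> 'b) set" where
  "Tens_map Y f p = (\<Union>(m, x)\<in>p. tens Y m (f x))"

text \<open>
  The quotient metric of \<open>M \<otimes> X\<close>, evaluated on representatives. Two copies of \<open>X\<close> meet in
  one point, and the second term of a minimum is the length of the way around through the
  third copy, which crosses it between two of its distinguished points.
\<close>

fun rep_dist :: "'a mtri \<Rightarrow> tag \<times> 'a \<Rightarrow> tag \<times> 'a \<Rightarrow> real" where
  "rep_dist X (M_a, x) (M_a, y) = 1/2 * dst X x y"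
| "rep_dist X (M_b, x) (M_b, y) = 1/2 * dst X x y"
| "rep_dist X (M_c, x) (M_c, y) = 1/2 * dst X x y"
| "rep_dist X (M_a, x) (M_b, y) =
     1/2 * min (dst X x (ptL X) + dst X (ptT X) y) (dst X x (ptR X) + 1 + dst X (ptR X) y)"
| "rep_dist X (M_a, x) (M_c, y) =
     1/2 * min (dst X x (ptR X) + dst X (ptT X) y) (dst X x (ptL X) + 1 + dst X (ptL X) y)"
| "rep_dist X (M_b, x) (M_c, y) =
     1/2 * min (dst X x (ptR X) + dst X (ptL X) y) (dst X x (ptT X) + 1 + dst X (ptT X) y)"
| "rep_dist X (M_b, x) (M_a, y) =
     1/2 * min (dst X y (ptL X) + dst X (ptT X) x) (dst X y (ptR X) + 1 + dst X (ptR X) x)"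
| "rep_dist X (M_c, x) (M_a, y) =
     1/2 * min (dst X y (ptR X) + dst X (ptT X) x) (dst X y (ptL X) + 1 + dst X (ptL X) x)"
| "rep_dist X (M_c, x) (M_b, y) =
     1/2 * min (dst X y (ptR X) + dst X (ptL X) x) (dst X y (ptT X) + 1 + dst X (ptT X) x)"

definition tens_dist :: "'a mtri \<Rightarrow> (tag \<times> 'a) set \<Rightarrow> (tag \<times> 'a) set \<Rightarrow> real" where
  "tens_dist X p q = the_elem (\<Union>u\<in>p. \<Union>v\<in>q. {rep_dist X u v})"

definition MTens :: "'a mtri \<Rightarrow> (tag \<times> 'a) set mtri" where
  "MTens X =
     \<lparr>pts = pts (Tens X), ptT = ptT (Tens X), ptL = ptL (Tens X), ptR = ptR (Tens X),
      dst = tens_dist X\<rparr>"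

text \<open>Classes are finite, and the metric does not depend on the representatives.\<close>

lemma tens_rel_cases:
  assumes "tri_pointed X" and "(p, q) \<in> tens_rel X"
  shows "p = q \<or> glue X p q \<or> glue X q p"
proof -
  have "equivclp (glue X) p q"
    using assms(2) by (auto simp: tens_rel_def equiv_gen_def)
  then show ?thesis
  proof (induction rule: equivclp_induct)
    case base
    then show ?case by simp
  next
    case (step y z)
    then show ?case
      using assms(1) by (auto simp: tri_pointed_def elim!: glue.cases)
  qed
qed

lemma finite_tens:
  assumes "tri_pointed X"
  shows "finite (tens X m x)"
proof -
  have "tens X m x \<subseteq> insert (m, x) (UNIV \<times> {ptT X, ptL X, ptR X})"
    using tens_rel_cases[OF assms] by (fastforce simp: tens_def elim!: glue.cases)
  moreover have "finite (UNIV :: tag set)"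
    by (rule finite_subset[of _ "{M_a, M_b, M_c}"]) (auto intro: tag.exhaust)
  ultimately show ?thesis
    by (auto intro: finite_subset)
qed

lemma rep_dist_commute:
  assumes "tri_metric X" and "snd p \<in> pts X" and "snd q \<in> pts X"
  shows "rep_dist X p q = rep_dist X q p"
proof -
  have "dst X x y = dst X y x" if "x \<in> pts X" "y \<in> pts X" for x y
    using assms(1) that Metric_space.commute[of "pts X" "dst_on X" x y]
    by (simp add: tri_metric_def dst_on_def)
  then show ?thesis
    using assms(2,3)
    by (cases p; cases q; cases "fst p"; cases "fst q") auto
qed

lemma rep_dist_glue:
  assumes X: "tri_metric X" and "glue X p p'" and q: "snd q \<in> pts X"
  shows "rep_dist X p q = rep_dist X p' q"
proof -
  have ms: "Metric_space (pts X) (dst_on X)"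
    using X by (simp add: tri_metric_def)
  have sym: "dst X x y = dst X y x" if "x \<in> pts X" "y \<in> pts X" for x y
    using Metric_space.commute[OF ms, of x y] that by (simp add: dst_on_def)
  have nn: "0 \<le> dst X x y" if "x \<in> pts X" "y \<in> pts X" for x y
    using Metric_space.nonneg[OF ms, of x y] that by (simp add: dst_on_def)
  have zero: "dst X x x = 0" if "x \<in> pts X" for x
    using Metric_space.mdist_zero[OF ms, of x] that by (simp add: dst_on_def)
  have le1: "dst X x y \<le> 1" if "x \<in> pts X" "y \<in> pts X" for x y
    using X that by (simp add: tri_metric_def)
  have pt: "ptT X \<in> pts X" "ptL X \<in> pts X" "ptR X \<in> pts X"
    and one: "dst X (ptT X) (ptL X) = 1" "dst X (ptT X) (ptR X) = 1" "dst X (ptL X) (ptR X) = 1"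
    using X by (auto simp: tri_metric_def tri_pointed_def)
  have one': "dst X (ptL X) (ptT X) = 1" "dst X (ptR X) (ptT X) = 1" "dst X (ptR X) (ptL X) = 1"
    using one sym pt by auto
  obtain n y where qq: "q = (n, y)" and y: "y \<in> pts X"
    using q by (cases q) auto
  note facts = pt[THEN zero] one one' nn[OF y pt(1)] nn[OF y pt(2)] nn[OF y pt(3)]
    le1[OF y pt(1)] le1[OF y pt(2)] le1[OF y pt(3)]
    sym[OF pt(1) y] sym[OF pt(2) y] sym[OF pt(3) y]
  show ?thesis
    using assms(2) facts unfolding qq
    by (cases n) (auto elim!: glue.cases simp: min_def)
qed

lemma rep_dist_cong:
  assumes X: "tri_metric X" and p: "(p, p') \<in> tens_rel X" and q: "(q, q') \<in> tens_rel X"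
  shows "rep_dist X p q = rep_dist X p' q'"
proof -
  have tp: "tri_pointed X"
    using X by (simp add: tri_metric_def)
  have mem: "snd p \<in> pts X" "snd p' \<in> pts X" "snd q \<in> pts X" "snd q' \<in> pts X"
    using p q by (auto simp: tens_rel_def equiv_gen_def)
  have "rep_dist X p q = rep_dist X p' q"
    using tens_rel_cases[OF tp p] rep_dist_glue[OF X _ mem(3)] by metis
  also have "\<dots> = rep_dist X q p'"
    by (rule rep_dist_commute[OF X mem(2,3)])
  also have "\<dots> = rep_dist X q' p'"
    using tens_rel_cases[OF tp q] rep_dist_glue[OF X _ mem(2)] by metis
  also have "\<dots> = rep_dist X p' q'"
    by (rule rep_dist_commute[OF X mem(4,2)])
  finally show ?thesis .
qed

lemma tens_dist_tens:
  assumes X: "tri_metric X" and "x \<in> pts X" and "y \<in> pts X"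
  shows "tens_dist X (tens X m x) (tens X n y) = rep_dist X (m, x) (n, y)"
proof -
  have "(m, x) \<in> tens X m x" "(n, y) \<in> tens X n y"
    using assms(2,3) by (auto simp: tens_def tens_rel_def equiv_gen_def)
  moreover have "rep_dist X u v = rep_dist X (m, x) (n, y)"
    if "u \<in> tens X m x" "v \<in> tens X n y" for u v
    using rep_dist_cong[OF X, of "(m, x)" u "(n, y)" v] that by (simp add: tens_def)
  ultimately have "(\<Union>u\<in>tens X m x. \<Union>v\<in>tens X n y. {rep_dist X u v}) = {rep_dist X (m, x) (n, y)}"
    by blast
  then show ?thesis
    by (simp add: tens_dist_def)
qed


section \<open>The spaces \<open>M\<^sup>n \<otimes> I\<close>\<close>

text \<open>
  Each application of \<open>M \<otimes> -\<close> changes the type of the elements. To have all the iterates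
  \<open>M\<^sup>n \<otimes> I\<close> in one type, the (finite) classes are stored in a datatype; \<open>cell\<close> and
  \<open>uncell\<close> convert between a class and its code.
\<close>

datatype corner = IT | IL | IR

datatype gterm = Pt corner | Cell "(tag \<times> gterm) fset"

definition cell :: "(tag \<times> gterm) set \<Rightarrow> gterm" where
  "cell C = Cell (Abs_fset C)"

primrec uncell :: "gterm \<Rightarrow> (tag \<times> gterm) set" where
  "uncell (Pt i) = {}"
| "uncell (Cell F) = fset F"

lemma uncell_cell: "finite C \<Longrightarrow> uncell (cell C) = C"
  by (simp add: cell_def Abs_fset_inverse)

definition I3 :: "gterm mtri" where
  "I3 = \<lparr>pts = range Pt, ptT = Pt IT, ptL = Pt IL, ptR = Pt IR,
         dst = (\<lambda>x y. if x = y then 0 else 1)\<rparr>"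

definition coded :: "(tag \<times> gterm) set mtri \<Rightarrow> gterm mtri" where
  "coded Y = \<lparr>pts = cell ` pts Y, ptT = cell (ptT Y), ptL = cell (ptL Y), ptR = cell (ptR Y),
              dst = (\<lambda>u v. dst Y (uncell u) (uncell v))\<rparr>"

primrec MI :: "nat \<Rightarrow> gterm mtri" where
  "MI 0 = I3"
| "MI (Suc n) = coded (MTens (MI n))"

text \<open>\<open>tw [m\<^sub>1, \<dots>, m\<^sub>n] x\<close> is the element \<open>m\<^sub>1 \<otimes> \<dots> \<otimes> m\<^sub>n \<otimes> x\<close> of \<open>M\<^sup>n \<otimes> I\<close>.\<close>

primrec tw :: "tag list \<Rightarrow> gterm \<Rightarrow> gterm" where
  "tw [] x = x"
| "tw (m # ms) x = cell (tens (MI (length ms)) m (tw ms x))"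

text \<open>\<open>chain n\<close> is the map \<open>M\<^sup>n \<otimes> !\<close> from \<open>M\<^sup>n \<otimes> I\<close> to \<open>M\<^sup>n\<^sup>+\<^sup>1 \<otimes> I\<close>; \<open>bang\<close> is \<open>!\<close>.\<close>

fun tag_of :: "corner \<Rightarrow> tag" where
  "tag_of IT = M_a"
| "tag_of IL = M_b"
| "tag_of IR = M_c"

primrec bang :: "gterm \<Rightarrow> gterm" where
  "bang (Pt i) = cell (tens I3 (tag_of i) (Pt i))"
| "bang (Cell F) = undefined"

primrec chain :: "nat \<Rightarrow> gterm \<Rightarrow> gterm" where
  "chain 0 = bang"
| "chain (Suc n) = (\<lambda>u. cell (Tens_map (MI (Suc n)) (chain n) (uncell u)))"


section \<open>The initial algebra\<close>

text \<open>The colimit of the chain, as a quotient of the disjoint union of the \<open>M\<^sup>n \<otimes> I\<close>.\<close>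

definition colim_pts :: "(nat \<times> gterm) set" where
  "colim_pts = (SIGMA n:UNIV. pts (MI n))"

definition colim_rel :: "(nat \<times> gterm) rel" where
  "colim_rel = equiv_gen colim_pts (\<lambda>(n, u) q. q = (Suc n, chain n u))"

definition Gcls :: "nat \<Rightarrow> gterm \<Rightarrow> (nat \<times> gterm) set" where
  "Gcls n u = colim_rel `` {(n, u)}"

text \<open>
  A class contains exactly one element of \<open>M\<^sup>p \<otimes> I\<close> for every large enough \<open>p\<close>, so the distance
  is taken between representatives at a common level \<open>p\<close>.
\<close>

definition G_dist :: "(nat \<times> gterm) set \<Rightarrow> (nat \<times> gterm) set \<Rightarrow> real" where
  "G_dist P Q = (THE r. \<exists>p u v. (p, u) \<in> P \<and> (p, v) \<in> Q \<and> r = dst (MI p) u v)"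

definition G3 :: "(nat \<times> gterm) set mtri" where
  "G3 = \<lparr>pts = colim_pts // colim_rel,
        ptT = Gcls 0 (Pt IT), ptL = Gcls 0 (Pt IL), ptR = Gcls 0 (Pt IR),
        dst = G_dist\<rparr>"

definition g_iso :: "(tag \<times> (nat \<times> gterm) set) set \<Rightarrow> (nat \<times> gterm) set" where
  "g_iso p = (\<Union>(m, P)\<in>p. \<Union>(n, u)\<in>P. Gcls (Suc n) (cell (tens (MI n) m u)))"


section \<open>Its Cauchy completion\<close>

definition cauchy_seqs :: "'a mtri \<Rightarrow> (nat \<Rightarrow> 'a) set" where
  "cauchy_seqs X = {\<sigma>. Metric_space.MCauchy (pts X) (dst_on X) \<sigma>}"

definition cauchy_rel :: "'a mtri \<Rightarrow> (nat \<Rightarrow> 'a) rel" where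
  "cauchy_rel X = {(\<sigma>, \<tau>). \<sigma> \<in> cauchy_seqs X \<and> \<tau> \<in> cauchy_seqs X \<and>
                     (\<lambda>n. dst X (\<sigma> n) (\<tau> n)) \<longlonglongrightarrow> 0}"

definition Scls :: "'a mtri \<Rightarrow> (nat \<Rightarrow> 'a) \<Rightarrow> (nat \<Rightarrow> 'a) set" where
  "Scls X \<sigma> = cauchy_rel X `` {\<sigma>}"

definition completion_emb :: "'a mtri \<Rightarrow> 'a \<Rightarrow> (nat \<Rightarrow> 'a) set" where
  "completion_emb X x = Scls X (\<lambda>_. x)"

definition completion_dist :: "'a mtri \<Rightarrow> (nat \<Rightarrow> 'a) set \<Rightarrow> (nat \<Rightarrow> 'a) set \<Rightarrow> real" where
  "completion_dist X P Q = the_elem (\<Union>\<sigma>\<in>P. \<Union>\<tau>\<in>Q. {lim (\<lambda>n. dst X (\<sigma> n) (\<tau> n))})"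

definition completion :: "'a mtri \<Rightarrow> (nat \<Rightarrow> 'a) set mtri" where
  "completion X =
     \<lparr>pts = cauchy_seqs X // cauchy_rel X,
      ptT = completion_emb X (ptT X), ptL = completion_emb X (ptL X),
      ptR = completion_emb X (ptR X),
      dst = completion_dist X\<rparr>"

definition S3 :: "(nat \<Rightarrow> (nat \<times> gterm) set) set mtri" where
  "S3 = completion G3"

definition s_iso ::
  "(tag \<times> (nat \<Rightarrow> (nat \<times> gterm) set) set) set \<Rightarrow> (nat \<Rightarrow> (nat \<times> gterm) set) set" where
  "s_iso p = (\<Union>(m, P)\<in>p. \<Union>\<sigma>\<in>P. Scls G3 (\<lambda>n. g_iso (tens G3 m (\<sigma> n))))"

definition psi ::
  "(nat \<Rightarrow> (nat \<times> gterm) set) set \<Rightarrow> (tag \<times> (nat \<Rightarrow> (nat \<times> gterm) set) set) set" where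
  "psi = inv_into (pts (Tens S3)) s_iso"


section \<open>Coalgebras and the sequences \<open>\<theta>\<^sub>n(x)\<close>\<close>

definition coalgebra3 :: "('a, 'z) tri_scheme \<Rightarrow> ('a \<Rightarrow> (tag \<times> 'a) set) \<Rightarrow> bool" where
  "coalgebra3 X e \<longleftrightarrow> tri_pointed X \<and> morphism3 X (Tens X) e"

text \<open>
  \<open>m\<close> and \<open>y\<close> are the sequences \<open>(m\<^sub>n)\<close> and \<open>(x\<^sub>n)\<close> chosen for \<open>x\<close>; \<open>m 0\<close> is not constrained.
\<close>

definition unfolds ::
  "('a, 'z) tri_scheme \<Rightarrow> ('a \<Rightarrow> (tag \<times> 'a) set) \<Rightarrow> 'a \<Rightarrow> (nat \<Rightarrow> tag) \<Rightarrow> (nat \<Rightarrow> 'a) \<Rightarrow> bool" where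
  "unfolds X e x m y \<longleftrightarrow>
     y 0 = x \<and> (\<forall>n\<ge>1. y n \<in> pts X \<and> e (y (n - 1)) = tens X (m n) (y n))"

fun corner_of :: "tag \<Rightarrow> corner" where
  "corner_of M_a = IT"
| "corner_of M_b = IL"
| "corner_of M_c = IR"

text \<open>
  Intended for \<open>n \<ge> 1\<close>; the value at \<open>0\<close> is an irrelevant point of \<open>G3\<close>.
\<close>

definition theta :: "(nat \<Rightarrow> tag) \<Rightarrow> nat \<Rightarrow> (nat \<times> gterm) set" where
  "theta m n = Gcls n (tw (map m [1..<Suc n]) (Pt (corner_of (m n))))"

definition is_theta_limit ::
  "(nat \<Rightarrow> tag) \<Rightarrow> (nat \<Rightarrow> (nat \<times> gterm) set) set \<Rightarrow> bool" where
  "is_theta_limit m l \<longleftrightarrow>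
     limitin (Metric_space.mtopology (pts S3) (dst_on S3)) (\<lambda>k. completion_emb G3 (theta m k)) l sequentially"

definition theta_lim :: "(nat \<Rightarrow> tag) \<Rightarrow> (nat \<Rightarrow> (nat \<times> gterm) set) set" where
  "theta_lim m = (THE l. is_theta_limit m l)"

end

theory Submission
  imports Defs
begin

text \<open>
  Write \<open>\<kappa>\<^sub>m\<close> for the distinguished point \<open>T\<close>, \<open>L\<close>, \<open>R\<close> according as \<open>m\<close> is \<open>a\<close>, \<open>b\<close>, \<open>c\<close>
  (\<open>tip X m\<close> below). Then \<open>M \<otimes> X\<close> glues \<open>(m, \<kappa>\<^sub>n)\<close> to \<open>(n, \<kappa>\<^sub>m)\<close> for all \<open>m \<noteq> n\<close>, which makes the three
  copies of \<open>X\<close> symmetric. The isometry \<open>s : M \<otimes> S \<rightarrow> S\<close> has an inverse, and each map \<open>s(m \<otimes> -)\<close>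
  halves distances, so a relation on \<open>S\<close> that is closed under stripping a common first letter
  relates only equal points. This contraction principle gives everything: the unfolding of a
  distinguished point \<open>\<kappa>\<^sub>m\<close> is forced to be \<open>m, m, \<dots>\<close> and has limit \<open>\<kappa>\<^sub>m\<close>; hence two unfoldings of the
  same element that first differ by a glued pair have the same limit, and the limit depends on the
  element only; and two morphisms into \<open>(S, \<psi>)\<close> agree.
\<close>

section \<open>Metrics on tri-pointed sets\<close>

definition tip :: "('a, 'z) tri_scheme \<Rightarrow> tag \<Rightarrow> 'a" where
  "tip X m = (case m of M_a \<Rightarrow> ptT X | M_b \<Rightarrow> ptL X | M_c \<Rightarrow> ptR X)"

lemma tip_mem: "tri_pointed X \<Longrightarrow> tip X m \<in> pts X"
  by (cases m) (auto simp: tip_def tri_pointed_def)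

lemma tip_morphism3: "morphism3 X Y f \<Longrightarrow> f (tip X m) = tip Y m"
  by (cases m) (auto simp: tip_def morphism3_def)

text \<open>Nonnegativity comes from the triangle inequality along x, y, x, and distinctness of the
  three points from their distance 1.\<close>

lemma tri_metricI:
  assumes tip: "\<And>m. tip X m \<in> pts X"
    and zero: "\<And>x y. x \<in> pts X \<Longrightarrow> y \<in> pts X \<Longrightarrow> dst X x y = 0 \<longleftrightarrow> x = y"
    and sym: "\<And>x y. x \<in> pts X \<Longrightarrow> y \<in> pts X \<Longrightarrow> dst X x y = dst X y x"
    and tri: "\<And>x y z. x \<in> pts X \<Longrightarrow> y \<in> pts X \<Longrightarrow> z \<in> pts X \<Longrightarrow>
                dst X x z \<le> dst X x y + dst X y z"
    and le1: "\<And>x y. x \<in> pts X \<Longrightarrow> y \<in> pts X \<Longrightarrow> dst X x y \<le> 1"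
    and one: "\<And>m n. m \<noteq> n \<Longrightarrow> dst X (tip X m) (tip X n) = 1"
  shows "tri_metric X"
proof -
  have "tip X m \<noteq> tip X n" if "m \<noteq> n" for m n
    using one[OF that] zero[OF tip tip, of m n] by auto
  from this[of M_a M_b] this[of M_a M_c] this[of M_b M_c]
  have "tri_pointed X"
    using tip[of M_a] tip[of M_b] tip[of M_c] by (simp add: tri_pointed_def tip_def)
  have nonneg: "0 \<le> dst X x y" if "x \<in> pts X" "y \<in> pts X" for x y
    using tri[OF that(1,2,1)] zero[OF that(1,1)] sym[OF that] by simp
  have "Metric_space (pts X) (dst_on X)"
    by unfold_locales (auto simp: dst_on_def nonneg zero sym tri)
  with \<open>tri_pointed X\<close> show ?thesis
    using le1 one[of M_a M_b] one[of M_a M_c] one[of M_b M_c] by (simp add: tri_metric_def tip_def)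
qed

context
  fixes X :: "'a mtri"
  assumes X: "tri_metric X"
begin

lemma metric_space: "Metric_space (pts X) (dst_on X)"
  using X by (simp add: tri_metric_def)

lemma tri_metric_pointed: "tri_pointed X"
  using X by (simp add: tri_metric_def)

lemma corner_mem: "ptT X \<in> pts X" "ptL X \<in> pts X" "ptR X \<in> pts X"
  using tri_metric_pointed by (auto simp: tri_pointed_def)

lemma dst_nonneg: "x \<in> pts X \<Longrightarrow> y \<in> pts X \<Longrightarrow> 0 \<le> dst X x y"
  using Metric_space.nonneg[OF metric_space, of x y] by (simp add: dst_on_def)

lemma dst_commute: "x \<in> pts X \<Longrightarrow> y \<in> pts X \<Longrightarrow> dst X x y = dst X y x"
  using Metric_space.commute[OF metric_space, of x y] by (simp add: dst_on_def)

lemma dst_zero_iff: "x \<in> pts X \<Longrightarrow> y \<in> pts X \<Longrightarrow> dst X x y = 0 \<longleftrightarrow> x = y"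
  using Metric_space.zero[OF metric_space, of x y] by (simp add: dst_on_def)

lemma dst_self: "x \<in> pts X \<Longrightarrow> dst X x x = 0"
  by (simp add: dst_zero_iff)

lemma dst_triangle:
  "x \<in> pts X \<Longrightarrow> y \<in> pts X \<Longrightarrow> z \<in> pts X \<Longrightarrow> dst X x z \<le> dst X x y + dst X y z"
  using Metric_space.triangle[OF metric_space, of x y z] by (simp add: dst_on_def)

lemma dst_le_1: "x \<in> pts X \<Longrightarrow> y \<in> pts X \<Longrightarrow> dst X x y \<le> 1"
  using X by (simp add: tri_metric_def)

lemma dst_corners:
  "dst X (ptT X) (ptL X) = 1" "dst X (ptT X) (ptR X) = 1" "dst X (ptL X) (ptR X) = 1"
  "dst X (ptL X) (ptT X) = 1" "dst X (ptR X) (ptT X) = 1" "dst X (ptR X) (ptL X) = 1"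
  using X corner_mem dst_commute[of "ptL X" "ptT X"] dst_commute[of "ptR X" "ptT X"]
    dst_commute[of "ptR X" "ptL X"]
  by (simp_all add: tri_metric_def)

end

definition isometry3 :: "'a mtri \<Rightarrow> 'b mtri \<Rightarrow> ('a \<Rightarrow> 'b) \<Rightarrow> bool" where
  "isometry3 X Y f \<longleftrightarrow>
     morphism3 X Y f \<and> (\<forall>x\<in>pts X. \<forall>y\<in>pts X. dst Y (f x) (f y) = dst X x y)"

text \<open>\<open>rep_dist\<close> is an expression in distances between x, y and the distinguished
  points, all of which \<open>f\<close> preserves. On representatives this says that M \<otimes> -
  preserves isometric embeddings.\<close>

lemma rep_dist_isometry3:
  assumes "tri_metric X" and f: "isometry3 X Y f" and "x \<in> pts X" and "y \<in> pts X"
  shows "rep_dist Y (m, f x) (n, f y) = rep_dist X (m, x) (n, y)"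
proof -
  have d: "dst Y (f u) (f v) = dst X u v" if "u \<in> pts X" "v \<in> pts X" for u v
    using f that by (simp add: isometry3_def)
  have "ptT Y = f (ptT X)" "ptL Y = f (ptL X)" "ptR Y = f (ptR X)"
    using f by (simp_all add: isometry3_def morphism3_def)
  then show ?thesis
    using assms(3,4) corner_mem[OF assms(1)] by (cases m; cases n) (simp_all add: d)
qed


section \<open>The functor on sets and on metrics\<close>

lemma tens_rel_iff:
  assumes "tri_pointed X"
  shows "(p, q) \<in> tens_rel X \<longleftrightarrow>
    snd p \<in> pts X \<and> snd q \<in> pts X \<and> (p = q \<or> glue X p q \<or> glue X q p)"
  using tens_rel_cases[OF assms, of p q]
  by (auto simp: tens_rel_def equiv_gen_def mem_Times_iff)

lemma pts_Tens_cases: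
  assumes "p \<in> pts (Tens X)"
  obtains m x where "x \<in> pts X" "p = tens X m x"
  using assms by (auto simp: Tens_def tens_def elim!: quotientE)

lemma tens_mem: "x \<in> pts X \<Longrightarrow> tens X m x \<in> pts (Tens X)"
  by (auto simp: Tens_def tens_def intro!: quotientI)

lemma mem_tens_self: "x \<in> pts X \<Longrightarrow> (m, x) \<in> tens X m x"
  by (auto simp: tens_def tens_rel_def equiv_gen_def)

lemma mem_tensD: "(n, y) \<in> tens X m x \<Longrightarrow> y \<in> pts X \<and> tens X n y = tens X m x"
  using equiv_class_eq[OF equiv_equiv_gen, of "(m, x)" "(n, y)" "UNIV \<times> pts X" "glue X"]
  by (auto simp: tens_def tens_rel_def) (simp add: equiv_gen_def)

lemma tens_eq_iff:
  assumes "x \<in> pts X" and "y \<in> pts X"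
  shows "tens X m x = tens X n y \<longleftrightarrow> ((m, x), (n, y)) \<in> tens_rel X"
  unfolding tens_def tens_rel_def using assms by (intro eq_equiv_class_iff[OF equiv_equiv_gen]) auto

lemma tens_eq_cases:
  assumes "tri_pointed X" and "x \<in> pts X" and "y \<in> pts X" and "tens X m x = tens X n y"
  shows "m = n \<and> x = y \<or> glue X (m, x) (n, y) \<or> glue X (n, y) (m, x)"
  using assms tens_eq_iff[of x X y m n] by (auto simp: tens_rel_iff)

lemma tens_glue:
  assumes "tri_pointed X" and "glue X (m, x) (n, y)"
  shows "tens X m x = tens X n y"
proof -
  have "x \<in> pts X" "y \<in> pts X"
    using assms by (auto simp: tri_pointed_def elim: glue.cases)
  then show ?thesis
    using assms by (simp add: tens_eq_iff tens_rel_iff)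
qed

lemma glue_morphism3:
  assumes "morphism3 X Y f" and "glue X (m, x) (n, y)"
  shows "glue Y (m, f x) (n, f y)"
  using assms(2) by (cases rule: glue.cases)
    (use assms(1) in \<open>auto simp: morphism3_def intro: glue.intros\<close>)

text \<open>Glued pairs go to glued pairs, so the union runs over copies of a single class, and (m,
  x) shows that it is not an empty union.\<close>

lemma Tens_map_tens:
  assumes X: "tri_pointed X" and Y: "tri_pointed Y" and f: "morphism3 X Y f" and x: "x \<in> pts X"
  shows "Tens_map Y f (tens X m x) = tens Y m (f x)"
proof -
  have "tens Y n (f y) = tens Y m (f x)" if "(n, y) \<in> tens X m x" for n y
  proof -
    have "y \<in> pts X" "tens X n y = tens X m x"
      using mem_tensD that by metis+
    then consider "n = m" "y = x" | "glue X (n, y) (m, x)" | "glue X (m, x) (n, y)"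
      using tens_eq_cases[OF X _ x] by blast
    then show ?thesis
      by cases (auto dest: glue_morphism3[OF f] tens_glue[OF Y])
  qed
  then have "Tens_map Y f (tens X m x) = (\<Union>q\<in>tens X m x. tens Y m (f x))"
    unfolding Tens_map_def by (intro SUP_cong refl) auto
  also have "\<dots> = tens Y m (f x)"
    using mem_tens_self[OF x] by blast
  finally show ?thesis .
qed

section \<open>The quotient metric on M \<otimes> X\<close>

lemma MTens_sel:
  "pts (MTens X) = pts (Tens X)" "ptT (MTens X) = tens X M_a (ptT X)"
  "ptL (MTens X) = tens X M_b (ptL X)" "ptR (MTens X) = tens X M_c (ptR X)"
  "dst (MTens X) = tens_dist X"
  by (simp_all add: MTens_def Tens_def)

lemma dst_tips: "tri_metric X \<Longrightarrow> m \<noteq> n \<Longrightarrow> dst X (tip X m) (tip X n) = 1"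
  by (cases m; cases n) (simp_all add: tip_def dst_corners)

text \<open>One condition stands for the three rules and their converses, so that later arguments
  run for arbitrary tags instead of by cases on them.\<close>

lemma glue_iff_tip:
  "glue X (m, x) (n, y) \<or> glue X (n, y) (m, x) \<longleftrightarrow> m \<noteq> n \<and> x = tip X n \<and> y = tip X m"
  by (cases m; cases n) (auto simp: tip_def glue.simps)

lemma tip_MTens: "tip (MTens X) m = tens X m (tip X m)"
  by (cases m) (simp_all add: tip_def MTens_sel)

lemma rep_dist_same: "rep_dist X (m, x) (m, y) = 1/2 * dst X x y"
  by (cases m) simp_all

lemma ex_third_tag: "\<exists>k :: tag. k \<noteq> m \<and> k \<noteq> n"
  by (cases m; cases n) blast+

text \<open>The six defining equations for different tags in one formula: \<open>k\<close> is the
  third tag, \<open>tip X n\<close> is the point of copy \<open>m\<close> where copy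
  \<open>n\<close> is attached, and the second term is the way through copy \<open>k\<close>.
  Measuring from x and from y makes the formula symmetric.\<close>

lemma rep_dist_tip:
  assumes X: "tri_metric X" and "x \<in> pts X" and "y \<in> pts X"
    and "m \<noteq> n" and "k \<noteq> m" and "k \<noteq> n"
  shows "rep_dist X (m, x) (n, y) =
    1/2 * min (dst X x (tip X n) + dst X y (tip X m)) (dst X x (tip X k) + 1 + dst X y (tip X k))"
  using assms(4-6) dst_commute[OF X assms(2)] dst_commute[OF X assms(3)] corner_mem[OF X]
  by (cases m; cases n; cases k) (simp_all add: tip_def add.commute)

text \<open>A path between the two tips through \<open>y\<close> is at least as long as their
  distance 1. This is the price of crossing a whole copy.\<close>

lemma dst_two_tips:
  assumes X: "tri_metric X" and y: "y \<in> pts X" and "m \<noteq> n"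
  shows "1 \<le> dst X y (tip X m) + dst X y (tip X n)"
  using dst_triangle[OF X _ y, of "tip X m" "tip X n"] dst_commute[OF X y, of "tip X m"] dst_tips[OF X assms(3)]
    tip_mem[OF tri_metric_pointed[OF X]] by simp

text \<open>Distance zero means being glued. Later one direction yields that \<open>g_iso\<close>
  and \<open>s_iso\<close> respect classes, and the other that \<open>s_iso\<close> is
  injective.\<close>

lemma rep_dist_zero_iff:
  assumes X: "tri_metric X" and x: "x \<in> pts X" and y: "y \<in> pts X"
  shows "rep_dist X (m, x) (n, y) = 0 \<longleftrightarrow> tens X m x = tens X n y"
proof (cases "m = n")
  case True
  then show ?thesis
    using x y dst_zero_iff[OF X x y] tens_eq_cases[OF tri_metric_pointed[OF X] x y, of m n] glue_iff_tip[of X m x n y]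
    by (auto simp: rep_dist_same)
next
  case False
  obtain k where k: "k \<noteq> m" "k \<noteq> n"
    using ex_third_tag by blast
  note tip = tip_mem[OF tri_metric_pointed[OF X]]
  note nn = dst_nonneg[OF X x tip] dst_nonneg[OF X y tip]
  \<comment> \<open>The way through the third copy has length at least 1/2, so only the direct way
    can have length 0.\<close>
  have "rep_dist X (m, x) (n, y) = 0 \<longleftrightarrow> dst X x (tip X n) = 0 \<and> dst X y (tip X m) = 0"
    unfolding rep_dist_tip[OF X x y False k]
    using nn(1)[of n] nn(2)[of m] nn(1)[of k] nn(2)[of k] by (auto simp: min_def)
  also have "\<dots> \<longleftrightarrow> tens X m x = tens X n y"
    using False glue_iff_tip[of X m x n y] dst_zero_iff[OF X x tip] dst_zero_iff[OF X y tip] x y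
    by (auto simp: tens_eq_iff tens_rel_iff[OF tri_metric_pointed[OF X]])
  finally show ?thesis .
qed

lemma rep_dist_sym:
  "tri_metric X \<Longrightarrow> x \<in> pts X \<Longrightarrow> y \<in> pts X \<Longrightarrow> rep_dist X (m, x) (n, y) = rep_dist X (n, y) (m, x)"
  using rep_dist_commute[of X "(m, x)" "(n, y)"] by simp

lemma rep_dist_le_1:
  assumes X: "tri_metric X" and x: "x \<in> pts X" and y: "y \<in> pts X"
  shows "rep_dist X (m, x) (n, y) \<le> 1"
proof (cases "m = n")
  case True
  then show ?thesis
    using dst_le_1[OF X x y] by (simp add: rep_dist_same)
next
  case False
  obtain k where k: "k \<noteq> m" "k \<noteq> n"
    using ex_third_tag by blast
  show ?thesis
    using dst_le_1[OF X x tip_mem[OF tri_metric_pointed[OF X]], of n]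
      dst_le_1[OF X y tip_mem[OF tri_metric_pointed[OF X]], of m]
    unfolding rep_dist_tip[OF X x y False k] by (auto simp: min_def)
qed

lemma rep_dist_tips:
  assumes X: "tri_metric X" and "m \<noteq> n"
  shows "rep_dist X (m, tip X m) (n, tip X n) = 1"
proof -
  obtain k where k: "k \<noteq> m" "k \<noteq> n"
    using ex_third_tag by blast
  note tip = tip_mem[OF tri_metric_pointed[OF X]]
  show ?thesis
    unfolding rep_dist_tip[OF X tip tip assms(2) k]
    using k assms(2) by (simp add: dst_tips[OF X])
qed

lemma rep_dist_triangle:
  assumes X: "tri_metric X" and x: "x \<in> pts X" and y: "y \<in> pts X" and z: "z \<in> pts X"
  shows "rep_dist X (m, x) (k, z) \<le> rep_dist X (m, x) (n, y) + rep_dist X (n, y) (k, z)"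
proof -
  note tip = tip_mem[OF tri_metric_pointed[OF X]]
  note nn = dst_nonneg[OF X _ tip]
  \<comment> \<open>Replacing u by v inside copy \<open>i\<close> changes each term of the minimum
    by at most their distance.\<close>
  have same_left: "rep_dist X (i, u) (j, w) \<le> rep_dist X (i, u) (i, v) + rep_dist X (i, v) (j, w)"
    if u: "u \<in> pts X" and v: "v \<in> pts X" and w: "w \<in> pts X" and ij: "i \<noteq> j" for i j u v w
  proof -
    obtain l where l: "l \<noteq> i" "l \<noteq> j"
      using ex_third_tag by blast
    have "dst X u (tip X j) \<le> dst X u v + dst X v (tip X j)"
      "dst X u (tip X l) \<le> dst X u v + dst X v (tip X l)"
      using dst_triangle[OF X u v tip] by blast+
    then show ?thesis
      unfolding rep_dist_same rep_dist_tip[OF X u w ij l] rep_dist_tip[OF X v w ij l]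
      by (simp add: min_def)
  qed
  consider "m = n" "n = k" | "m = n" "n \<noteq> k" | "m \<noteq> n" "n = k" | "m \<noteq> n" "m = k"
    | "m \<noteq> n" "n \<noteq> k" "m \<noteq> k"
    by blast
  then show ?thesis
  proof cases
    case 1
    then show ?thesis
      using dst_triangle[OF X x y z] by (simp add: rep_dist_same)
  next
    case 2
    then show ?thesis
      using same_left[OF x y z] by simp
  next
    case 3
    then show ?thesis
      using same_left[OF z y x, of k m] x y z by (simp add: rep_dist_sym[OF X])
  next
    case 4
    obtain l where l: "l \<noteq> m" "l \<noteq> n"
      using ex_third_tag by blast
    have "dst X x z \<le> dst X x (tip X n) + dst X z (tip X n)"
      using dst_triangle[OF X x tip z, of n] dst_commute[OF X z tip] by simp
    \<comment> \<open>The path leaves copy \<open>m\<close> for copy \<open>n\<close> and returns.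
      Two direct ways both pass through \<open>tip X n\<close>, which the previous inequality
      covers; a detour contributes 1, which already bounds the distance of x and z.\<close>
    then have "dst X x z \<le> min (dst X x (tip X n) + dst X y (tip X m)) (dst X x (tip X l) + 1 + dst X y (tip X l))
      + min (dst X z (tip X n) + dst X y (tip X m)) (dst X z (tip X l) + 1 + dst X y (tip X l))"
      using dst_le_1[OF X x z] nn[OF x, of n] nn[OF x, of l] nn[OF y, of m] nn[OF y, of l]
        nn[OF z, of n] nn[OF z, of l] by (simp add: min_def)
    moreover have "rep_dist X (n, y) (m, z) = rep_dist X (m, z) (n, y)"
      by (rule rep_dist_sym[OF X y z])
    ultimately show ?thesis
      unfolding 4(2)[symmetric] rep_dist_same rep_dist_tip[OF X x y 4(1) l]
        rep_dist_tip[OF X z y 4(1) l] by simp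
  next
    case 5
    \<comment> \<open>With three different tags, two direct ways cross copy \<open>n\<close> at cost
      at least 1, so they dominate the detour from x to z through copy \<open>n\<close>. If one of
      the two ways is a detour, its extra 1 pays for the missing leg of the direct way from x to
      z.\<close>
    note D = rep_dist_tip[OF X x z, of m k n] rep_dist_tip[OF X x y, of m n k]
      rep_dist_tip[OF X y z, of n k m]
    show ?thesis
      using 5 D dst_two_tips[OF X y, of m k] dst_le_1[OF X x tip, of k] dst_le_1[OF X z tip, of m]
        nn[OF x, of n] nn[OF x, of k] nn[OF y, of m] nn[OF y, of k] nn[OF z, of m] nn[OF z, of n]
      by (simp add: min_def split: if_splits)
  qed
qed

lemma tri_metric_MTens:
  assumes X: "tri_metric X"
  shows "tri_metric (MTens X)"
proof (rule tri_metricI)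
  show "tip (MTens X) m \<in> pts (MTens X)" for m
    unfolding tip_MTens MTens_sel by (intro tens_mem tip_mem tri_metric_pointed X)
next
  fix p q
  assume "p \<in> pts (MTens X)" "q \<in> pts (MTens X)"
  then obtain m x n y where *: "p = tens X m x" "q = tens X n y" "x \<in> pts X" "y \<in> pts X"
    by (metis MTens_sel(1) pts_Tens_cases)
  show "dst (MTens X) p q = 0 \<longleftrightarrow> p = q" "dst (MTens X) p q = dst (MTens X) q p"
    "dst (MTens X) p q \<le> 1"
    using * rep_dist_sym[OF X] rep_dist_le_1[OF X]
    by (simp_all add: MTens_sel tens_dist_tens[OF X] rep_dist_zero_iff[OF X])
next
  fix p q r
  assume "p \<in> pts (MTens X)" "q \<in> pts (MTens X)" "r \<in> pts (MTens X)"
  then obtain m x n y k z where *: "p = tens X m x" "q = tens X n y" "r = tens X k z"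
    "x \<in> pts X" "y \<in> pts X" "z \<in> pts X"
    by (metis MTens_sel(1) pts_Tens_cases)
  then show "dst (MTens X) p r \<le> dst (MTens X) p q + dst (MTens X) q r"
    using rep_dist_triangle[OF X] by (simp add: MTens_sel tens_dist_tens[OF X])
next
  show "dst (MTens X) (tip (MTens X) m) (tip (MTens X) n) = 1" if "m \<noteq> n" for m n
    using that tip_mem[OF tri_metric_pointed[OF X]]
    by (simp add: tip_MTens MTens_sel(5) tens_dist_tens[OF X] rep_dist_tips[OF X])
qed

lemma isometry3D:
  assumes "isometry3 X Y f"
  shows "x \<in> pts X \<Longrightarrow> f x \<in> pts Y" "f (tip X m) = tip Y m"
    "x \<in> pts X \<Longrightarrow> y \<in> pts X \<Longrightarrow> dst Y (f x) (f y) = dst X x y"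
  using assms tip_morphism3[of X Y f m] by (auto simp: isometry3_def morphism3_def)

lemma isometry3_inj:
  assumes "tri_metric X" "isometry3 X Y f" "x \<in> pts X" "y \<in> pts X" "f x = f y"
  shows "x = y"
proof -
  have "dst X x y = dst Y (f x) (f x)"
    using isometry3D(3)[OF assms(2,3,4)] assms(5) by simp
  also have "\<dots> = 0"
    using isometry3D(3)[OF assms(2,3,3)] dst_self[OF assms(1,3)] by simp
  finally show ?thesis
    using dst_zero_iff[OF assms(1,3,4)] by simp
qed

lemma isometry3_comp:
  "isometry3 X Y f \<Longrightarrow> isometry3 Y Z g \<Longrightarrow> isometry3 X Z (\<lambda>x. g (f x))"
  by (auto simp: isometry3_def morphism3_def Pi_iff)

text \<open>Transport of structure: each axiom is pulled back along \<open>f\<close>. It carries the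
  metric of \<open>MTens\<close> over to its coded copy.\<close>

lemma tri_metric_image:
  assumes X: "tri_metric X" and f: "isometry3 X Y f" and surj: "pts Y = f ` pts X"
  shows "tri_metric Y"
proof (rule tri_metricI)
  note d = isometry3D(3)[OF f]
  show "tip Y m \<in> pts Y" for m
    using isometry3D(1)[OF f tip_mem[OF tri_metric_pointed[OF X]]] by (simp add: isometry3D(2)[OF f])
  show "dst Y (tip Y m) (tip Y n) = 1" if "m \<noteq> n" for m n
    using that by (simp add: isometry3D(2)[OF f, symmetric] d tip_mem[OF tri_metric_pointed[OF X]] dst_tips[OF X])
  fix x y
  assume "x \<in> pts Y" "y \<in> pts Y"
  then obtain u v where *: "x = f u" "y = f v" "u \<in> pts X" "v \<in> pts X"
    by (auto simp: surj)
  show "dst Y x y = 0 \<longleftrightarrow> x = y" "dst Y x y = dst Y y x" "dst Y x y \<le> 1"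
    using * dst_zero_iff[OF X] dst_commute[OF X, of u v] dst_le_1[OF X] isometry3_inj[OF X f]
    by (auto simp: d)
  fix z
  assume "z \<in> pts Y"
  then obtain w where "z = f w" "w \<in> pts X"
    by (auto simp: surj)
  then show "dst Y x z \<le> dst Y x y + dst Y y z"
    using * dst_triangle[OF X, of u v w] by (simp add: d)
qed


section \<open>The chain and its colimit\<close>

lemma finite_pts_Tens: "tri_pointed X \<Longrightarrow> p \<in> pts (Tens X) \<Longrightarrow> finite p"
  using finite_tens by (metis pts_Tens_cases)

text \<open>Classes are finite, so \<open>uncell\<close> recovers a class from its code.\<close>

lemma isometry3_cell:
  assumes "tri_metric X"
  shows "isometry3 (MTens X) (coded (MTens X)) cell"
  using finite_pts_Tens[OF tri_metric_pointed[OF assms]]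
  by (auto simp: isometry3_def morphism3_def coded_def MTens_sel uncell_cell)

lemma tri_metric_I3: "tri_metric I3"
  by (rule tri_metricI) (auto simp: I3_def tip_def split: tag.splits)

lemma tri_metric_MI: "tri_metric (MI n)"
proof (induction n)
  case 0
  then show ?case
    by (simp add: tri_metric_I3)
next
  case (Suc n)
  have "pts (coded (MTens (MI n))) = cell ` pts (MTens (MI n))"
    by (simp add: coded_def)
  then show ?case
    using tri_metric_image[OF tri_metric_MTens isometry3_cell] Suc by simp
qed

lemmas tri_pointed_MI = tri_metric_pointed[OF tri_metric_MI]

definition act :: "nat \<Rightarrow> tag \<Rightarrow> gterm \<Rightarrow> gterm" where
  "act n m u = cell (tens (MI n) m u)"

lemma act_mem: "u \<in> pts (MI n) \<Longrightarrow> act n m u \<in> pts (MI (Suc n))"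
  by (simp add: act_def coded_def MTens_sel tens_mem)

lemma act_cases:
  assumes "p \<in> pts (MI (Suc n))"
  obtains m u where "u \<in> pts (MI n)" "p = act n m u"
  using assms by (auto simp: act_def coded_def MTens_sel elim: pts_Tens_cases)

lemma dst_act:
  "u \<in> pts (MI n) \<Longrightarrow> v \<in> pts (MI n) \<Longrightarrow>
    dst (MI (Suc n)) (act n m u) (act n k v) = rep_dist (MI n) (m, u) (k, v)"
  using tens_mem[of u "MI n" m] tens_mem[of v "MI n" k]
  by (simp add: act_def coded_def MTens_sel uncell_cell finite_tens tri_pointed_MI tens_dist_tens[OF tri_metric_MI])

lemma act_tip: "act n m (tip (MI n) m) = tip (MI (Suc n)) m"
  by (cases m) (simp_all add: act_def tip_def coded_def MTens_sel)

text \<open>\<open>Tens_map\<close> can be evaluated on representatives only for a morphism. That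
  \<open>chain n\<close> is one is a hypothesis here, because it is proved by an induction whose
  step uses this equation.\<close>

lemma chain_Suc_act:
  assumes "morphism3 (MI n) (MI (Suc n)) (chain n)" and "u \<in> pts (MI n)"
  shows "chain (Suc n) (act n m u) = act (Suc n) m (chain n u)"
  using Tens_map_tens[OF tri_pointed_MI tri_pointed_MI assms, of m]
  by (simp add: act_def uncell_cell finite_tens tri_pointed_MI del: MI.simps)

lemma morphism3_tipI:
  "f \<in> pts X \<rightarrow> pts Y \<Longrightarrow> (\<And>m. f (tip X m) = tip Y m) \<Longrightarrow> morphism3 X Y f"
  unfolding morphism3_def using tip_def[of X M_a] tip_def[of X M_b] tip_def[of X M_c]
    tip_def[of Y M_a] tip_def[of Y M_b] tip_def[of Y M_c] by (metis tag.case)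

text \<open>Level 0 consists of the three tips, which go to tips, and different tips have distance 1
  at every level. At level n + 1 the map is M \<otimes> \<open>chain n\<close>, and
  \<open>rep_dist\<close> is invariant under isometries.\<close>

lemma isometry3_chain: "isometry3 (MI n) (MI (Suc n)) (chain n)"
proof (induction n)
  case 0
  have pts: "pts (MI 0) = range (tip (MI 0))"
  proof -
    have "Pt i = tip (MI 0) (tag_of i)" for i
      by (cases i) (simp_all add: tip_def I3_def)
    moreover have "tip (MI 0) m \<in> range Pt" for m
      by (cases m) (simp_all add: tip_def I3_def)
    moreover have "pts (MI 0) = range Pt"
      by (simp add: I3_def)
    ultimately show ?thesis
      by auto
  qed
  have tip: "chain 0 (tip (MI 0) m) = tip (MI (Suc 0)) m" for m
    by (cases m) (simp_all add: tip_def I3_def coded_def MTens_sel)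
  have "dst (MI (Suc 0)) (tip (MI (Suc 0)) m) (tip (MI (Suc 0)) n) = dst (MI 0) (tip (MI 0) m) (tip (MI 0) n)"
    for m n
    by (cases "m = n")
      (simp_all add: dst_self[OF tri_metric_MI] tip_mem[OF tri_pointed_MI] dst_tips[OF tri_metric_MI] del: MI.simps)
  then show ?case
    using tip tip_mem[OF tri_pointed_MI, of "Suc 0"]
    unfolding isometry3_def by (intro conjI morphism3_tipI) (auto simp: pts simp del: MI.simps chain.simps)
next
  case (Suc n)
  have mor: "morphism3 (MI n) (MI (Suc n)) (chain n)"
    using Suc by (simp add: isometry3_def)
  note act = chain_Suc_act[OF mor]
  note cmem = isometry3D(1)[OF Suc]
  have mem: "chain (Suc n) p \<in> pts (MI (Suc (Suc n)))" if p: "p \<in> pts (MI (Suc n))" for p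
    using act_cases[OF p] by (metis act act_mem cmem)
  have tip: "chain (Suc n) (tip (MI (Suc n)) m) = tip (MI (Suc (Suc n))) m" for m
    by (metis act act_tip isometry3D(2)[OF Suc] tip_mem tri_pointed_MI)
  have "dst (MI (Suc (Suc n))) (chain (Suc n) p) (chain (Suc n) q) = dst (MI (Suc n)) p q"
    if p: "p \<in> pts (MI (Suc n))" and q: "q \<in> pts (MI (Suc n))" for p q
  proof -
    obtain m u k v where "u \<in> pts (MI n)" "p = act n m u" "v \<in> pts (MI n)" "q = act n k v"
      using act_cases[OF p] act_cases[OF q] by metis
    then show ?thesis
      using rep_dist_isometry3[OF tri_metric_MI Suc]
      by (simp add: act dst_act cmem del: MI.simps chain.simps)
  qed
  then show ?case
    using mem tip unfolding isometry3_def by (auto intro!: morphism3_tipI simp del: MI.simps chain.simps)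
qed

section \<open>The colimit and its metric\<close>

primrec up :: "nat \<Rightarrow> nat \<Rightarrow> gterm \<Rightarrow> gterm" where
  "up n 0 u = u"
| "up n (Suc k) u = chain (n + k) (up n k u)"

lemma up_chain: "up (Suc n) k (chain n u) = up n (Suc k) u"
  by (induction k) simp_all

lemma isometry3_up: "isometry3 (MI n) (MI (n + k)) (up n k)"
proof (induction k)
  case 0
  then show ?case
    by (simp add: isometry3_def morphism3_def)
next
  case (Suc k)
  then show ?case
    using isometry3_comp[OF Suc isometry3_chain] by (simp del: MI.simps)
qed

lemma equiv_colim_rel: "equiv colim_pts colim_rel"
  unfolding colim_rel_def by (rule equiv_equiv_gen)

lemma Gcls_eq_iff:
  "u \<in> pts (MI n) \<Longrightarrow> v \<in> pts (MI k) \<Longrightarrow> Gcls n u = Gcls k v \<longleftrightarrow> ((n, u), (k, v)) \<in> colim_rel"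
  unfolding Gcls_def by (rule eq_equiv_class_iff[OF equiv_colim_rel]) (simp_all add: colim_pts_def)

lemma mem_GclsD: "(k, v) \<in> Gcls n u \<Longrightarrow> v \<in> pts (MI k) \<and> Gcls k v = Gcls n u"
  using equiv_class_eq[OF equiv_colim_rel, of "(n, u)" "(k, v)"]
  by (auto simp: Gcls_def) (auto simp: colim_rel_def equiv_gen_def colim_pts_def)

lemma mem_Gcls_self: "u \<in> pts (MI n) \<Longrightarrow> (n, u) \<in> Gcls n u"
  unfolding Gcls_def by (rule equiv_class_self[OF equiv_colim_rel]) (simp add: colim_pts_def)

lemma Gcls_chain:
  assumes "u \<in> pts (MI n)"
  shows "Gcls (Suc n) (chain n u) = Gcls n u"
proof -
  have "chain n u \<in> pts (MI (Suc n))"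
    by (rule isometry3D(1)[OF isometry3_chain assms])
  then have "((n, u), (Suc n, chain n u)) \<in> colim_rel"
    using assms by (auto simp: colim_rel_def equiv_gen_def colim_pts_def simp del: MI.simps)
  then show ?thesis
    unfolding Gcls_def by (metis equiv_class_eq[OF equiv_colim_rel])
qed

lemma Gcls_up: "u \<in> pts (MI n) \<Longrightarrow> Gcls (n + k) (up n k u) = Gcls n u"
  by (induction k) (simp_all add: Gcls_chain isometry3D(1)[OF isometry3_up])

text \<open>The usual description of a sequential colimit, by induction along a zigzag of links. A
  forward link adds one chain map on the side of \<open>p\<close>; a backward link adds one on the
  other side.\<close>

lemma colim_rel_up:
  assumes "(p, q) \<in> colim_rel"
  shows "\<exists>i j. fst p + i = fst q + j \<and> up (fst p) i (snd p) = up (fst q) j (snd q)"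
proof -
  have "equivclp (\<lambda>(n, u) q. q = (Suc n, chain n u)) p q"
    using assms by (simp add: colim_rel_def equiv_gen_def)
  then show ?thesis
  proof (induction rule: equivclp_induct)
    case base
    then show ?case
      by blast
  next
    case (step q r)
    obtain i j where ij: "fst p + i = fst q + j" "up (fst p) i (snd p) = up (fst q) j (snd q)"
      using step.IH by blast
    from step.hyps(2) consider "r = (Suc (fst q), chain (fst q) (snd q))"
      | "q = (Suc (fst r), chain (fst r) (snd r))"
      by (auto simp: case_prod_beta)
    then show ?case
    proof cases
      case 1
      have "fst p + Suc i = fst r + j" "up (fst p) (Suc i) (snd p) = up (fst r) j (snd r)"
        using ij 1 by (simp_all add: up_chain)
      then show ?thesis
        by blast
    next
      case 2
      have "fst q = Suc (fst r)" "snd q = chain (fst r) (snd r)"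
        using 2 by (metis fst_conv, metis snd_conv)
      then have "fst p + i = fst r + Suc j" "up (fst p) i (snd p) = up (fst r) (Suc j) (snd r)"
        using ij by (simp_all only: up_chain)
      then show ?thesis
        by blast
    qed
  qed
qed

text \<open>At equal levels both elements are moved up by the same number of steps, and the
  composite chain maps are injective.\<close>

lemma Gcls_inj:
  assumes u: "u \<in> pts (MI n)" and v: "v \<in> pts (MI n)" and eq: "Gcls n u = Gcls n v"
  shows "u = v"
proof -
  obtain i j where "n + i = n + j" "up n i u = up n j v"
    using eq colim_rel_up[of "(n, u)" "(n, v)"] by (auto simp: Gcls_eq_iff[OF u v])
  then show ?thesis
    using isometry3_inj[OF tri_metric_MI isometry3_up u v] by simp
qed

lemma Gcls_mem: "u \<in> pts (MI n) \<Longrightarrow> Gcls n u \<in> pts G3"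
  unfolding G3_def Gcls_def by (auto simp: colim_pts_def intro!: quotientI)

lemma pts_G3_cases:
  assumes "P \<in> pts G3"
  obtains n u where "u \<in> pts (MI n)" "P = Gcls n u"
  using assms by (auto simp: G3_def Gcls_def colim_pts_def elim!: quotientE)

lemma Gcls_common_level:
  assumes "u \<in> pts (MI n)" and "v \<in> pts (MI k)"
  obtains p u' v' where "u' \<in> pts (MI p)" "v' \<in> pts (MI p)"
    "Gcls n u = Gcls p u'" "Gcls k v = Gcls p v'" "p = n + k" "u' = up n k u" "v' = up k n v"
  using that[of "up n k u" "n + k" "up k n v"] Gcls_up[OF assms(1), of k] Gcls_up[OF assms(2), of n]
    isometry3D(1)[OF isometry3_up assms(1), of k] isometry3D(1)[OF isometry3_up assms(2), of n]
  by (simp add: add.commute)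

text \<open>The definite description in \<open>G_dist\<close> has a unique value because chain maps
  are isometric: any two pairs of representatives can be compared at one higher level.\<close>

lemma dst_Gcls:
  assumes u: "u \<in> pts (MI n)" and v: "v \<in> pts (MI n)"
  shows "dst G3 (Gcls n u) (Gcls n v) = dst (MI n) u v"
proof -
  have unique: "dst (MI p) u' v' = dst (MI n) u v"
    if "(p, u') \<in> Gcls n u" "(p, v') \<in> Gcls n v" for p u' v'
  proof -
    have *: "u' \<in> pts (MI p)" "Gcls p u' = Gcls n u" "v' \<in> pts (MI p)" "Gcls p v' = Gcls n v"
      using that mem_GclsD by blast+
    \<comment> \<open>Representatives of one class at levels \<open>p\<close> and \<open>n\<close>
      coincide once both are moved to level \<open>p + n\<close>.\<close>
    have "up p n w' = up n p w" if "w' \<in> pts (MI p)" "w \<in> pts (MI n)" "Gcls p w' = Gcls n w" for w w'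
    proof (rule Gcls_inj)
      show "up p n w' \<in> pts (MI (p + n))" "up n p w \<in> pts (MI (p + n))"
        using isometry3D(1)[OF isometry3_up that(1), of n] isometry3D(1)[OF isometry3_up that(2), of p]
        by (simp_all add: add.commute)
      show "Gcls (p + n) (up p n w') = Gcls (p + n) (up n p w)"
        using Gcls_up[OF that(1), of n] Gcls_up[OF that(2), of p] that(3) by (simp add: add.commute)
    qed
    then have "up p n u' = up n p u" "up p n v' = up n p v"
      using * u v by auto
    then show ?thesis
      using isometry3D(3)[OF isometry3_up *(1,3), of n] isometry3D(3)[OF isometry3_up u v, of p]
      by (simp add: add.commute)
  qed
  have "G_dist (Gcls n u) (Gcls n v) = dst (MI n) u v"
    unfolding G_dist_def
  proof (rule the_equality)
    show "\<exists>p u' v'. (p, u') \<in> Gcls n u \<and> (p, v') \<in> Gcls n v \<and> dst (MI n) u v = dst (MI p) u' v'"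
      using mem_Gcls_self[OF u] mem_Gcls_self[OF v] by blast
  qed (use unique in blast)
  then show ?thesis
    by (simp add: G3_def)
qed

lemma tip_G3: "tip G3 m = Gcls n (tip (MI n) m)"
proof (induction n)
  case 0
  then show ?case
    by (cases m) (simp_all add: tip_def G3_def I3_def)
next
  case (Suc n)
  then show ?case
    using Gcls_chain[OF tip_mem[OF tri_pointed_MI], of n m] isometry3D(2)[OF isometry3_chain, of n m]
    by simp
qed

lemma isometry3_Gcls: "isometry3 (MI n) G3 (Gcls n)"
  unfolding isometry3_def by (auto intro!: morphism3_tipI simp: Gcls_mem dst_Gcls simp flip: tip_G3)

text \<open>Every axiom concerns at most three points. These have representatives at a common level,
  where the metric is already available.\<close>

lemma tri_metric_G3: "tri_metric G3"
proof (rule tri_metricI)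
  show "tip G3 m \<in> pts G3" for m
    using isometry3D[OF isometry3_Gcls[of 0]] tip_mem[OF tri_pointed_MI, of 0] by metis
  show "dst G3 (tip G3 m) (tip G3 n) = 1" if "m \<noteq> n" for m n
    using that by (simp add: tip_G3[of _ 0] dst_Gcls tip_mem[OF tri_pointed_MI] dst_tips[OF tri_metric_MI] del: MI.simps)
next
  fix P Q
  assume "P \<in> pts G3" "Q \<in> pts G3"
  then obtain p u v where *: "u \<in> pts (MI p)" "v \<in> pts (MI p)" "P = Gcls p u" "Q = Gcls p v"
    by (metis pts_G3_cases Gcls_common_level)
  show "dst G3 P Q = 0 \<longleftrightarrow> P = Q" "dst G3 P Q = dst G3 Q P" "dst G3 P Q \<le> 1"
    using * dst_zero_iff[OF tri_metric_MI *(1,2)] dst_commute[OF tri_metric_MI *(1,2)]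
      dst_le_1[OF tri_metric_MI *(1,2)] Gcls_inj[OF *(1,2)]
    by (auto simp: dst_Gcls)
next
  fix P Q R
  assume "P \<in> pts G3" "Q \<in> pts G3" "R \<in> pts G3"
  then obtain p u v k w where *: "u \<in> pts (MI p)" "v \<in> pts (MI p)" "P = Gcls p u" "Q = Gcls p v"
    "w \<in> pts (MI k)" "R = Gcls k w"
    by (metis pts_G3_cases Gcls_common_level)
  have "up p k u \<in> pts (MI (p + k))" "up p k v \<in> pts (MI (p + k))" "up k p w \<in> pts (MI (p + k))"
    "P = Gcls (p + k) (up p k u)" "Q = Gcls (p + k) (up p k v)" "R = Gcls (p + k) (up k p w)"
    using * Gcls_up isometry3D(1)[OF isometry3_up] by (auto simp: add.commute[of p k]) (metis add.commute)+
  then show "dst G3 P R \<le> dst G3 P Q + dst G3 Q R"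
    using dst_triangle[OF tri_metric_MI] by (simp add: dst_Gcls)
qed

section \<open>The algebra structure on the colimit\<close>

lemma rep_dist_Gcls:
  "u \<in> pts (MI n) \<Longrightarrow> v \<in> pts (MI n) \<Longrightarrow>
    rep_dist G3 (m, Gcls n u) (k, Gcls n v) = rep_dist (MI n) (m, u) (k, v)"
  by (rule rep_dist_isometry3[OF tri_metric_MI isometry3_Gcls])

text \<open>Prefixing a letter commutes with the chain maps, so the class of m \<otimes> u does not
  depend on the level at which u is represented.\<close>

lemma Gcls_act_up:
  assumes "u \<in> pts (MI n)"
  shows "Gcls (Suc (n + k)) (act (n + k) m (up n k u)) = Gcls (Suc n) (act n m u)"
proof (induction k)
  case (Suc k)
  let ?v = "up n k u"
  have v: "?v \<in> pts (MI (n + k))"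
    by (rule isometry3D(1)[OF isometry3_up assms])
  have "act (Suc (n + k)) m (chain (n + k) ?v) = chain (Suc (n + k)) (act (n + k) m ?v)"
    using chain_Suc_act isometry3_chain v by (simp add: isometry3_def)
  then show ?case
    using Suc Gcls_chain[OF act_mem[OF v]] by simp
qed simp

lemma dst_Gcls_act:
  assumes u: "u \<in> pts (MI n)" and v: "v \<in> pts (MI j)"
  shows "dst G3 (Gcls (Suc n) (act n m u)) (Gcls (Suc j) (act j k v)) =
    rep_dist G3 (m, Gcls n u) (k, Gcls j v)"
proof -
  let ?u = "up n j u" and ?v = "up j n v"
  have mem: "?u \<in> pts (MI (n + j))" "?v \<in> pts (MI (n + j))"
    using isometry3D(1)[OF isometry3_up u, of j] isometry3D(1)[OF isometry3_up v, of n]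
    by (simp_all add: add.commute)
  have "Gcls (Suc n) (act n m u) = Gcls (Suc (n + j)) (act (n + j) m ?u)"
    "Gcls (Suc j) (act j k v) = Gcls (Suc (n + j)) (act (n + j) k ?v)"
    "Gcls n u = Gcls (n + j) ?u" "Gcls j v = Gcls (n + j) ?v"
    using Gcls_act_up[OF u, of j m] Gcls_act_up[OF v, of n k] Gcls_up[OF u, of j] Gcls_up[OF v, of n]
    by (simp_all add: add.commute)
  then show ?thesis
    using mem by (simp add: dst_Gcls act_mem dst_act rep_dist_Gcls del: MI.simps)
qed

text \<open>Well-definedness comes from the metric: other representatives of the class are at
  \<open>rep_dist\<close> 0, so by \<open>dst_Gcls_act\<close> their images are at distance 0 and
  coincide.\<close>

lemma g_iso_tens:
  assumes u: "u \<in> pts (MI n)"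
  shows "g_iso (tens G3 m (Gcls n u)) = Gcls (Suc n) (act n m u)"
proof -
  have "Gcls (Suc j) (act j k v) = Gcls (Suc n) (act n m u)"
    if kP: "(k, P) \<in> tens G3 m (Gcls n u)" and jv: "(j, v) \<in> P" for j k v P
  proof -
    have "P \<in> pts G3" and eq: "tens G3 k P = tens G3 m (Gcls n u)"
      using mem_tensD[OF kP] by auto
    then have v: "v \<in> pts (MI j)" "P = Gcls j v"
      using mem_GclsD jv by (metis pts_G3_cases)+
    have "rep_dist G3 (k, Gcls j v) (m, Gcls n u) = 0"
      using eq v u by (simp add: rep_dist_zero_iff[OF tri_metric_G3] Gcls_mem)
    then show ?thesis
      using dst_zero_iff[OF tri_metric_G3 Gcls_mem[OF act_mem] Gcls_mem[OF act_mem]] u v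
      by (metis dst_Gcls_act)
  qed
  moreover have "(m, Gcls n u) \<in> tens G3 m (Gcls n u)" "(n, u) \<in> Gcls n u"
    using u by (simp_all add: mem_tens_self Gcls_mem mem_Gcls_self)
  ultimately show ?thesis
    unfolding g_iso_def act_def by fast
qed

definition gact :: "tag \<Rightarrow> (nat \<times> gterm) set \<Rightarrow> (nat \<times> gterm) set" where
  "gact m P = g_iso (tens G3 m P)"

lemma gact_mem: "P \<in> pts G3 \<Longrightarrow> gact m P \<in> pts G3"
  by (erule pts_G3_cases) (simp add: gact_def g_iso_tens Gcls_mem act_mem del: MI.simps)

lemma dst_gact:
  assumes "P \<in> pts G3" and "Q \<in> pts G3"
  shows "dst G3 (gact m P) (gact k Q) = rep_dist G3 (m, P) (k, Q)"
  using assms by (elim pts_G3_cases) (simp add: gact_def g_iso_tens dst_Gcls_act)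

lemma gact_tip: "gact m (tip G3 m) = tip G3 m"
  using tip_G3[of m 0] tip_G3[of m "Suc 0"] g_iso_tens[OF tip_mem[OF tri_pointed_MI], of m 0 m]
  by (simp add: gact_def act_tip del: MI.simps)

text \<open>Surjectivity of g: moving a representative one level up makes it begin with a letter,
  even if it came from level 0.\<close>

lemma gact_cases:
  assumes "P \<in> pts G3"
  obtains m Q where "Q \<in> pts G3" "P = gact m Q"
proof -
  obtain n u where u: "u \<in> pts (MI n)" "P = Gcls n u"
    using assms by (rule pts_G3_cases)
  then have "P = Gcls (Suc n) (chain n u)" "chain n u \<in> pts (MI (Suc n))"
    using Gcls_chain isometry3D(1)[OF isometry3_chain] by auto
  then show ?thesis
    using that by (metis act_cases g_iso_tens Gcls_mem gact_def)
qed

section \<open>The Cauchy completion\<close>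

lemma dst_quadrilateral:
  assumes X: "tri_metric X" and "x \<in> pts X" "y \<in> pts X" "x' \<in> pts X" "y' \<in> pts X"
  shows "\<bar>dst X x y - dst X x' y'\<bar> \<le> dst X x x' + dst X y y'"
  using dst_triangle[OF X, of x x' y] dst_triangle[OF X, of x' y' y] dst_triangle[OF X, of x' x y']
    dst_triangle[OF X, of x y y'] dst_commute[OF X, of x x'] dst_commute[OF X, of y y'] assms(2-5)
  by simp

context
  fixes X :: "'a mtri"
  assumes X: "tri_metric X"
begin

lemma cauchy_seqs_iff:
  "\<sigma> \<in> cauchy_seqs X \<longleftrightarrow>
    (\<forall>n. \<sigma> n \<in> pts X) \<and> (\<forall>\<epsilon>>0. \<exists>N. \<forall>n\<ge>N. \<forall>k\<ge>N. dst X (\<sigma> n) (\<sigma> k) < \<epsilon>)"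
proof -
  have "dst_on X (\<sigma> n) (\<sigma> k) = dst X (\<sigma> n) (\<sigma> k)" if "range \<sigma> \<subseteq> pts X" for n k
    using that by (simp add: dst_on_def range_subsetD)
  then show ?thesis
    by (auto simp: cauchy_seqs_def Metric_space.MCauchy_def[OF metric_space[OF X]] image_subset_iff)
qed

lemma cauchyE:
  assumes "\<sigma> \<in> cauchy_seqs X" and "\<epsilon> > 0"
  obtains N where "\<And>n k. n \<ge> N \<Longrightarrow> k \<ge> N \<Longrightarrow> dst X (\<sigma> n) (\<sigma> k) < \<epsilon>"
  using assms unfolding cauchy_seqs_iff by blast

lemma const_cauchy: "x \<in> pts X \<Longrightarrow> (\<lambda>_. x) \<in> cauchy_seqs X"
  by (simp add: cauchy_seqs_iff dst_self[OF X])

lemma cauchy_mem: "\<sigma> \<in> cauchy_seqs X \<Longrightarrow> \<sigma> n \<in> pts X"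
  by (simp add: cauchy_seqs_iff)

lemma cauchy_subseq:
  assumes \<sigma>: "\<sigma> \<in> cauchy_seqs X" and r: "strict_mono r"
  shows "\<sigma> \<circ> r \<in> cauchy_seqs X" and "(\<sigma> \<circ> r, \<sigma>) \<in> cauchy_rel X"
proof -
  have C: "\<exists>N. \<forall>n\<ge>N. \<forall>k\<ge>N. dst X (\<sigma> n) (\<sigma> k) < \<epsilon>" if "\<epsilon> > 0" for \<epsilon>
    using \<sigma> that by (simp add: cauchy_seqs_iff)
  have le: "n \<le> r n" for n
    by (rule seq_suble[OF r])
  show *: "\<sigma> \<circ> r \<in> cauchy_seqs X"
    using \<sigma> C unfolding cauchy_seqs_iff comp_def by (meson le order_trans)
  have "(\<lambda>n. dst X (\<sigma> (r n)) (\<sigma> n)) \<longlonglongrightarrow> 0"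
  proof (rule LIMSEQ_I)
    fix \<epsilon> :: real
    assume "\<epsilon> > 0"
    then obtain N where N: "\<And>n k. n \<ge> N \<Longrightarrow> k \<ge> N \<Longrightarrow> dst X (\<sigma> n) (\<sigma> k) < \<epsilon>"
      using C by blast
    have "norm (dst X (\<sigma> (r n)) (\<sigma> n) - 0) < \<epsilon>" if "n \<ge> N" for n
      using N[of "r n" n] that le[of n] dst_nonneg[OF X cauchy_mem[OF \<sigma>] cauchy_mem[OF \<sigma>]] by simp
    then show "\<exists>N. \<forall>n\<ge>N. norm (dst X (\<sigma> (r n)) (\<sigma> n) - 0) < \<epsilon>"
      by blast
  qed
  then show "(\<sigma> \<circ> r, \<sigma>) \<in> cauchy_rel X"
    using \<sigma> * by (simp add: cauchy_rel_def)
qed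

lemma convergent_dst:
  assumes \<sigma>: "\<sigma> \<in> cauchy_seqs X" and \<tau>: "\<tau> \<in> cauchy_seqs X"
  shows "convergent (\<lambda>n. dst X (\<sigma> n) (\<tau> n))"
proof -
  have "Cauchy (\<lambda>n. dst X (\<sigma> n) (\<tau> n))"
  proof (rule CauchyI)
    fix \<epsilon> :: real
    assume "\<epsilon> > 0"
    then have "\<epsilon> / 2 > 0"
      by simp
    from cauchyE[OF \<sigma> this] obtain N where
      N: "\<And>n k. n \<ge> N \<Longrightarrow> k \<ge> N \<Longrightarrow> dst X (\<sigma> n) (\<sigma> k) < \<epsilon> / 2"
      by blast
    from cauchyE[OF \<tau> \<open>\<epsilon> / 2 > 0\<close>] obtain N' where
      N': "\<And>n k. n \<ge> N' \<Longrightarrow> k \<ge> N' \<Longrightarrow> dst X (\<tau> n) (\<tau> k) < \<epsilon> / 2"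
      by blast
    have "norm (dst X (\<sigma> n) (\<tau> n) - dst X (\<sigma> k) (\<tau> k)) < \<epsilon>" if "n \<ge> max N N'" "k \<ge> max N N'" for n k
      using N[of n k] N'[of n k] that dst_quadrilateral[OF X cauchy_mem[OF \<sigma>] cauchy_mem[OF \<tau>] cauchy_mem[OF \<sigma>] cauchy_mem[OF \<tau>], of n n k k]
      by simp
    then show "\<exists>M. \<forall>m\<ge>M. \<forall>n\<ge>M. norm (dst X (\<sigma> m) (\<tau> m) - dst X (\<sigma> n) (\<tau> n)) < \<epsilon>"
      by blast
  qed
  then show ?thesis
    by (simp add: Cauchy_convergent)
qed

lemma cauchy_relD:
  "(\<sigma>, \<tau>) \<in> cauchy_rel X \<Longrightarrow>
    \<sigma> \<in> cauchy_seqs X \<and> \<tau> \<in> cauchy_seqs X \<and> (\<lambda>n. dst X (\<sigma> n) (\<tau> n)) \<longlonglongrightarrow> 0"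
  by (simp add: cauchy_rel_def)

text \<open>By the quadrilateral inequality the two sequences of distances differ by a null
  sequence. Both transitivity of \<open>cauchy_rel\<close> and well-definedness of
  \<open>completion_dist\<close> rest on this.\<close>

lemma dst_limit_cong:
  assumes "(\<sigma>, \<sigma>') \<in> cauchy_rel X" and "(\<tau>, \<tau>') \<in> cauchy_rel X"
    and lim: "(\<lambda>n. dst X (\<sigma> n) (\<tau> n)) \<longlonglongrightarrow> r"
  shows "(\<lambda>n. dst X (\<sigma>' n) (\<tau>' n)) \<longlonglongrightarrow> r"
proof -
  note a = cauchy_relD[OF assms(1)] cauchy_relD[OF assms(2)]
  have *: "(\<lambda>n. dst X (\<sigma> n) (\<sigma>' n) + dst X (\<tau> n) (\<tau>' n)) \<longlonglongrightarrow> 0"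
    using tendsto_add[of "\<lambda>n. dst X (\<sigma> n) (\<sigma>' n)" 0 sequentially "\<lambda>n. dst X (\<tau> n) (\<tau>' n)" 0] a
    by simp
  have "\<forall>n. norm (dst X (\<sigma> n) (\<tau> n) - dst X (\<sigma>' n) (\<tau>' n)) \<le> dst X (\<sigma> n) (\<sigma>' n) + dst X (\<tau> n) (\<tau>' n)"
    using dst_quadrilateral[OF X] a by (simp add: cauchy_mem)
  from Lim_null_comparison[OF always_eventually[OF this] *]
  have "(\<lambda>n. dst X (\<sigma> n) (\<tau> n) - dst X (\<sigma>' n) (\<tau>' n)) \<longlonglongrightarrow> 0" .
  from tendsto_diff[OF lim this] show ?thesis
    by simp
qed

lemma equiv_cauchy_rel: "equiv (cauchy_seqs X) (cauchy_rel X)"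
proof (rule equivI)
  show "cauchy_rel X \<subseteq> cauchy_seqs X \<times> cauchy_seqs X"
    by (auto simp: cauchy_rel_def)
  show refl: "refl_on (cauchy_seqs X) (cauchy_rel X)"
    by (auto simp: refl_on_def cauchy_rel_def cauchy_mem dst_self[OF X])
  show "sym (cauchy_rel X)"
    using dst_commute[OF X] by (auto simp: sym_def cauchy_rel_def cauchy_mem)
  show "trans (cauchy_rel X)"
  proof (rule transI)
    fix \<rho> \<sigma> \<tau>
    assume "(\<rho>, \<sigma>) \<in> cauchy_rel X" "(\<sigma>, \<tau>) \<in> cauchy_rel X"
    moreover have "(\<rho>, \<rho>) \<in> cauchy_rel X"
      using calculation refl by (auto simp: refl_on_def cauchy_rel_def)
    \<comment> \<open>The distances from \<rho> to \<sigma> tend to 0, and they keep this limit when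
      \<sigma> is replaced by the equivalent \<tau>.\<close>
    ultimately show "(\<rho>, \<tau>) \<in> cauchy_rel X"
      using dst_limit_cong[of \<rho> \<rho> \<sigma> \<tau> 0] by (auto simp: cauchy_rel_def)
  qed
qed

lemma Scls_eq_iff:
  "\<sigma> \<in> cauchy_seqs X \<Longrightarrow> \<tau> \<in> cauchy_seqs X \<Longrightarrow> Scls X \<sigma> = Scls X \<tau> \<longleftrightarrow> (\<sigma>, \<tau>) \<in> cauchy_rel X"
  unfolding Scls_def by (rule eq_equiv_class_iff[OF equiv_cauchy_rel])

lemma mem_Scls_self: "\<sigma> \<in> cauchy_seqs X \<Longrightarrow> \<sigma> \<in> Scls X \<sigma>"
  unfolding Scls_def by (rule equiv_class_self[OF equiv_cauchy_rel])

lemma mem_SclsD: "\<tau> \<in> Scls X \<sigma> \<Longrightarrow> \<tau> \<in> cauchy_seqs X \<and> Scls X \<tau> = Scls X \<sigma>"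
  using equiv_class_eq[OF equiv_cauchy_rel, of \<sigma> \<tau>] by (auto simp: Scls_def dest: cauchy_relD)

lemma Scls_mem: "\<sigma> \<in> cauchy_seqs X \<Longrightarrow> Scls X \<sigma> \<in> pts (completion X)"
  by (auto simp: completion_def Scls_def intro!: quotientI)

lemma pts_completion_cases:
  assumes "P \<in> pts (completion X)"
  obtains \<sigma> where "\<sigma> \<in> cauchy_seqs X" "P = Scls X \<sigma>"
  using assms by (auto simp: completion_def Scls_def elim!: quotientE)

text \<open>All pairs of representatives give the same limit, so \<open>the_elem\<close> is applied
  to a singleton.\<close>

lemma tendsto_dst_completion:
  assumes \<sigma>: "\<sigma> \<in> cauchy_seqs X" and \<tau>: "\<tau> \<in> cauchy_seqs X"
  shows "(\<lambda>n. dst X (\<sigma> n) (\<tau> n)) \<longlonglongrightarrow> dst (completion X) (Scls X \<sigma>) (Scls X \<tau>)"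
proof -
  obtain r where r: "(\<lambda>n. dst X (\<sigma> n) (\<tau> n)) \<longlonglongrightarrow> r"
    using convergent_dst[OF assms] by (auto simp: convergent_def)
  have "lim (\<lambda>n. dst X (\<sigma>' n) (\<tau>' n)) = r" if "\<sigma>' \<in> Scls X \<sigma>" "\<tau>' \<in> Scls X \<tau>" for \<sigma>' \<tau>'
    using that r by (intro limI dst_limit_cong[of \<sigma> \<sigma>' \<tau> \<tau>']) (auto simp: Scls_def)
  then have "(\<Union>\<sigma>'\<in>Scls X \<sigma>. \<Union>\<tau>'\<in>Scls X \<tau>. {lim (\<lambda>n. dst X (\<sigma>' n) (\<tau>' n))}) = {r}"
    using mem_Scls_self[OF \<sigma>] mem_Scls_self[OF \<tau>] by blast
  then show ?thesis
    using r by (simp add: completion_def completion_dist_def)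
qed

lemma tip_completion: "tip (completion X) m = Scls X (\<lambda>_. tip X m)"
  by (cases m) (simp_all add: tip_def completion_def completion_emb_def)

lemma dst_completion_const:
  assumes "x \<in> pts X" and "y \<in> pts X"
  shows "dst (completion X) (Scls X (\<lambda>_. x)) (Scls X (\<lambda>_. y)) = dst X x y"
  using tendsto_dst_completion[OF const_cauchy const_cauchy, OF assms] LIMSEQ_unique tendsto_const by metis

text \<open>Symmetry, the triangle inequality and the bound 1 pass to limits, and distance 0 is the
  relation that defines the classes.\<close>

lemma tri_metric_completion: "tri_metric (completion X)"
proof (rule tri_metricI)
  note tip = tip_mem[OF tri_metric_pointed[OF X]]
  show "tip (completion X) m \<in> pts (completion X)" for m
    by (simp add: tip_completion Scls_mem const_cauchy tip)
  show "dst (completion X) (tip (completion X) m) (tip (completion X) n) = 1" if "m \<noteq> n" for m n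
    using that by (simp add: tip_completion dst_completion_const tip dst_tips[OF X])
next
  fix P Q
  assume "P \<in> pts (completion X)" "Q \<in> pts (completion X)"
  then obtain \<sigma> \<tau> where *: "P = Scls X \<sigma>" "Q = Scls X \<tau>" "\<sigma> \<in> cauchy_seqs X" "\<tau> \<in> cauchy_seqs X"
    by (metis pts_completion_cases)
  note lim = tendsto_dst_completion[OF *(3,4), folded *(1,2)]
  show "dst (completion X) P Q = 0 \<longleftrightarrow> P = Q"
  proof
    assume "dst (completion X) P Q = 0"
    with lim have "(\<sigma>, \<tau>) \<in> cauchy_rel X"
      using * by (simp add: cauchy_rel_def)
    then show "P = Q"
      using * by (simp add: Scls_eq_iff)
  next
    assume "P = Q"
    then have "(\<lambda>n. dst X (\<sigma> n) (\<tau> n)) \<longlonglongrightarrow> 0"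
      using * by (simp add: Scls_eq_iff cauchy_rel_def)
    then show "dst (completion X) P Q = 0"
      by (rule LIMSEQ_unique[OF lim])
  qed
  have "(\<lambda>n. dst X (\<sigma> n) (\<tau> n)) \<longlonglongrightarrow> dst (completion X) Q P"
    using tendsto_dst_completion[OF *(4,3)] dst_commute[OF X cauchy_mem[OF *(3)] cauchy_mem[OF *(4)]]
    by (simp add: *(1,2))
  then show "dst (completion X) P Q = dst (completion X) Q P"
    by (rule LIMSEQ_unique[OF lim])
  show "dst (completion X) P Q \<le> 1"
    using lim by (rule LIMSEQ_le_const2) (simp add: dst_le_1[OF X] cauchy_mem *)
  fix R
  assume "R \<in> pts (completion X)"
  then obtain \<rho> where \<rho>: "\<rho> \<in> cauchy_seqs X" "R = Scls X \<rho>"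
    by (metis pts_completion_cases)
  have "(\<lambda>n. dst X (\<sigma> n) (\<rho> n)) \<longlonglongrightarrow> dst (completion X) P R"
    using * \<rho> by (simp add: tendsto_dst_completion)
  moreover have "(\<lambda>n. dst X (\<sigma> n) (\<tau> n) + dst X (\<tau> n) (\<rho> n)) \<longlonglongrightarrow> dst (completion X) P Q + dst (completion X) Q R"
    using * \<rho> by (simp add: tendsto_add tendsto_dst_completion)
  ultimately show "dst (completion X) P R \<le> dst (completion X) P Q + dst (completion X) Q R"
    by (rule LIMSEQ_le) (use * \<rho> dst_triangle[OF X] cauchy_mem in blast)
qed

lemma limitin_Scls:
  assumes \<sigma>: "\<sigma> \<in> cauchy_seqs X"
  shows "limitin (Metric_space.mtopology (pts (completion X)) (dst_on (completion X)))
    (\<lambda>k. completion_emb X (\<sigma> k)) (Scls X \<sigma>) sequentially"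
proof -
  have mem: "completion_emb X (\<sigma> k) \<in> pts (completion X)" for k
    by (simp add: completion_emb_def Scls_mem const_cauchy cauchy_mem \<sigma>)
  have "\<exists>N. \<forall>k\<ge>N. dst (completion X) (completion_emb X (\<sigma> k)) (Scls X \<sigma>) < \<epsilon>" if "\<epsilon> > 0" for \<epsilon>
  proof -
    have "\<epsilon> / 2 > 0"
      using that by simp
    from cauchyE[OF \<sigma> this] obtain N where
      N: "\<And>n k. n \<ge> N \<Longrightarrow> k \<ge> N \<Longrightarrow> dst X (\<sigma> n) (\<sigma> k) < \<epsilon> / 2"
      by blast
    \<comment> \<open>The limit over n turns the strict bound into a weak one; starting from half of
      \<epsilon> makes it strict again.\<close>
    have "dst (completion X) (completion_emb X (\<sigma> k)) (Scls X \<sigma>) \<le> \<epsilon> / 2" if "k \<ge> N" for k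
      unfolding completion_emb_def
    proof (rule LIMSEQ_le_const2)
      show "(\<lambda>n. dst X (\<sigma> k) (\<sigma> n)) \<longlonglongrightarrow> dst (completion X) (Scls X (\<lambda>_. \<sigma> k)) (Scls X \<sigma>)"
        by (rule tendsto_dst_completion[OF const_cauchy[OF cauchy_mem[OF \<sigma>]] \<sigma>])
      show "\<exists>M. \<forall>n\<ge>M. dst X (\<sigma> k) (\<sigma> n) \<le> \<epsilon> / 2"
        using N that less_imp_le by blast
    qed
    moreover have "\<epsilon> / 2 < \<epsilon>"
      using that by simp
    ultimately show ?thesis
      by (meson le_less_trans)
  qed
  then show ?thesis
    using mem Scls_mem[OF \<sigma>]
    unfolding Metric_space.limitin_metric[OF metric_space[OF tri_metric_completion]]
    by (auto simp: eventually_sequentially dst_on_def)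
qed

text \<open>\<open>rep_dist\<close> is continuous in the distances it involves, and the tips of the
  completion are classes of constant sequences.\<close>

lemma tendsto_rep_dist:
  assumes \<sigma>: "\<sigma> \<in> cauchy_seqs X" and \<tau>: "\<tau> \<in> cauchy_seqs X"
  shows "(\<lambda>n. rep_dist X (m, \<sigma> n) (k, \<tau> n)) \<longlonglongrightarrow> rep_dist (completion X) (m, Scls X \<sigma>) (k, Scls X \<tau>)"
proof (cases "m = k")
  case True
  then show ?thesis
    by (auto simp: rep_dist_same intro!: tendsto_intros tendsto_dst_completion assms)
next
  case False
  obtain l where l: "l \<noteq> m" "l \<noteq> k"
    using ex_third_tag by blast
  have tip: "(\<lambda>_. tip X j) \<in> cauchy_seqs X" for j
    by (simp add: const_cauchy tip_mem[OF tri_metric_pointed[OF X]])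
  show ?thesis
    unfolding rep_dist_tip[OF X cauchy_mem[OF \<sigma>] cauchy_mem[OF \<tau>] False l]
      rep_dist_tip[OF tri_metric_completion Scls_mem[OF \<sigma>] Scls_mem[OF \<tau>] False l] tip_completion
    by (intro tendsto_intros tendsto_min tendsto_dst_completion assms tip)
qed

end

section \<open>The algebra structure on the completion\<close>

lemma tri_metric_S3: "tri_metric S3"
  unfolding S3_def by (rule tri_metric_completion[OF tri_metric_G3])

text \<open>Distances are halved exactly, so the Cauchy property is reflected as well as preserved;
  reflection is what surjectivity of s requires.\<close>

lemma gact_cauchy_iff:
  assumes "\<And>n. \<sigma> n \<in> pts G3"
  shows "(\<lambda>n. gact m (\<sigma> n)) \<in> cauchy_seqs G3 \<longleftrightarrow> \<sigma> \<in> cauchy_seqs G3"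
proof -
  have "(\<forall>\<epsilon>>0. \<exists>N. \<forall>n\<ge>N. \<forall>k\<ge>N. 1/2 * dst G3 (\<sigma> n) (\<sigma> k) < \<epsilon>) \<longleftrightarrow>
    (\<forall>\<epsilon>>0. \<exists>N. \<forall>n\<ge>N. \<forall>k\<ge>N. dst G3 (\<sigma> n) (\<sigma> k) < \<epsilon>)" (is "?L \<longleftrightarrow> ?R")
  proof
    assume L: ?L
    show ?R
    proof (intro allI impI)
      fix \<epsilon> :: real assume "\<epsilon> > 0"
      then show "\<exists>N. \<forall>n\<ge>N. \<forall>k\<ge>N. dst G3 (\<sigma> n) (\<sigma> k) < \<epsilon>"
        using L[rule_format, of "\<epsilon> / 2"] by simp
    qed
  next
    assume R: ?R
    show ?L
    proof (intro allI impI)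
      fix \<epsilon> :: real assume "\<epsilon> > 0"
      then show "\<exists>N. \<forall>n\<ge>N. \<forall>k\<ge>N. 1/2 * dst G3 (\<sigma> n) (\<sigma> k) < \<epsilon>"
        using R[rule_format, of "2 * \<epsilon>"] by (simp add: mult.commute)
    qed
  qed
  then show ?thesis
    using assms by (simp add: cauchy_seqs_iff[OF tri_metric_G3] gact_mem dst_gact rep_dist_same)
qed

lemma gact_cauchy: "\<sigma> \<in> cauchy_seqs G3 \<Longrightarrow> (\<lambda>n. gact m (\<sigma> n)) \<in> cauchy_seqs G3"
  using gact_cauchy_iff[of \<sigma> m] by (simp add: cauchy_mem[OF tri_metric_G3])

definition sact ::
  "tag \<Rightarrow> (nat \<Rightarrow> (nat \<times> gterm) set) set \<Rightarrow> (nat \<Rightarrow> (nat \<times> gterm) set) set" where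
  "sact m P = s_iso (tens S3 m P)"

text \<open>Both sides are limits of the same real sequence, since g is isometric at every
  index.\<close>

lemma dst_Scls_gact:
  assumes "\<sigma> \<in> cauchy_seqs G3" and "\<tau> \<in> cauchy_seqs G3"
  shows "dst S3 (Scls G3 (\<lambda>n. gact m (\<sigma> n))) (Scls G3 (\<lambda>n. gact k (\<tau> n))) =
    rep_dist S3 (m, Scls G3 \<sigma>) (k, Scls G3 \<tau>)"
proof (rule LIMSEQ_unique)
  show "(\<lambda>n. dst G3 (gact m (\<sigma> n)) (gact k (\<tau> n))) \<longlonglongrightarrow>
    dst S3 (Scls G3 (\<lambda>n. gact m (\<sigma> n))) (Scls G3 (\<lambda>n. gact k (\<tau> n)))"
    unfolding S3_def by (intro tendsto_dst_completion tri_metric_G3 gact_cauchy assms)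
  show "(\<lambda>n. dst G3 (gact m (\<sigma> n)) (gact k (\<tau> n))) \<longlonglongrightarrow> rep_dist S3 (m, Scls G3 \<sigma>) (k, Scls G3 \<tau>)"
    using tendsto_rep_dist[OF tri_metric_G3 assms, of m k] assms
    by (simp add: S3_def dst_gact cauchy_mem[OF tri_metric_G3])
qed

lemmas S3_mem = Scls_mem[OF tri_metric_G3, folded S3_def]
  and pts_S3_cases = pts_completion_cases[OF tri_metric_G3, folded S3_def]

text \<open>As for g, representatives of one class are at \<open>rep_dist\<close> 0, hence have
  images at distance 0.\<close>

lemma sact_Scls:
  assumes \<sigma>: "\<sigma> \<in> cauchy_seqs G3"
  shows "sact m (Scls G3 \<sigma>) = Scls G3 (\<lambda>n. gact m (\<sigma> n))"
proof -
  have "Scls G3 (\<lambda>n. gact k (\<tau> n)) = Scls G3 (\<lambda>n. gact m (\<sigma> n))"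
    if kP: "(k, P) \<in> tens S3 m (Scls G3 \<sigma>)" and "\<tau> \<in> P" for k \<tau> P
  proof -
    have "P \<in> pts S3" and eq: "tens S3 k P = tens S3 m (Scls G3 \<sigma>)"
      using mem_tensD[OF kP] by auto
    then obtain \<rho> where "P = Scls G3 \<rho>"
      using pts_S3_cases by blast
    then have \<tau>: "\<tau> \<in> cauchy_seqs G3" "P = Scls G3 \<tau>"
      using mem_SclsD[OF tri_metric_G3, of \<tau> \<rho>] \<open>\<tau> \<in> P\<close> by auto
    have "rep_dist S3 (k, Scls G3 \<tau>) (m, Scls G3 \<sigma>) = 0"
      using eq \<tau> \<sigma> by (simp add: rep_dist_zero_iff[OF tri_metric_S3] S3_mem)
    then show ?thesis
      using dst_zero_iff[OF tri_metric_S3 S3_mem[OF gact_cauchy] S3_mem[OF gact_cauchy]] \<sigma> \<tau>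
      by (simp add: dst_Scls_gact)
  qed
  moreover have "(m, Scls G3 \<sigma>) \<in> tens S3 m (Scls G3 \<sigma>)" "\<sigma> \<in> Scls G3 \<sigma>"
    using \<sigma> by (simp_all add: mem_tens_self S3_mem mem_Scls_self[OF tri_metric_G3])
  ultimately show ?thesis
    unfolding sact_def s_iso_def gact_def by fast
qed

lemma sact_mem: "P \<in> pts S3 \<Longrightarrow> sact m P \<in> pts S3"
  by (erule pts_S3_cases) (simp add: sact_Scls S3_mem gact_cauchy)

lemma dst_sact:
  assumes "P \<in> pts S3" and "Q \<in> pts S3"
  shows "dst S3 (sact m P) (sact k Q) = rep_dist S3 (m, P) (k, Q)"
  using assms by (elim pts_S3_cases) (simp add: sact_Scls dst_Scls_gact)

lemma sact_tip: "sact m (tip S3 m) = tip S3 m"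
proof -
  have "(\<lambda>_. tip G3 m) \<in> cauchy_seqs G3"
    by (intro const_cauchy tri_metric_G3 tip_mem tri_metric_pointed)
  then show ?thesis
    by (simp add: tip_completion[OF tri_metric_G3, folded S3_def] sact_Scls gact_tip)
qed

text \<open>Surjectivity of s. Each term of a Cauchy sequence has some first letter; infinitely many
  terms share one, and the subsequence of these terms represents the same point. Stripping the
  common letter leaves a Cauchy sequence.\<close>

lemma sact_cases:
  assumes "P \<in> pts S3"
  obtains m Q where "Q \<in> pts S3" "P = sact m Q"
proof -
  obtain \<sigma> where \<sigma>: "\<sigma> \<in> cauchy_seqs G3" "P = Scls G3 \<sigma>"
    using assms by (rule pts_S3_cases)
  have "\<exists>m Q. Q \<in> pts G3 \<and> \<sigma> n = gact m Q" for n
    using gact_cases[OF cauchy_mem[OF tri_metric_G3 \<sigma>(1)], of n] by blast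
  then have "\<exists>t \<tau>. \<forall>n. \<tau> n \<in> pts G3 \<and> \<sigma> n = gact (t n) (\<tau> n)"
    by metis
  then obtain t \<tau> where \<tau>: "\<And>n. \<tau> n \<in> pts G3" "\<And>n. \<sigma> n = gact (t n) (\<tau> n)"
    by blast
  have "t n \<in> {M_a, M_b, M_c}" for n
    by (cases "t n") simp_all
  then have "range t \<subseteq> {M_a, M_b, M_c}"
    by (rule image_subsetI)
  then have "finite (range t)"
    by (rule finite_subset) simp
  \<comment> \<open>\<open>n\<^sub>0\<close> is an index whose letter occurs infinitely often, and
    \<open>r\<close> enumerates its occurrences.\<close>
  from pigeonhole_infinite[OF infinite_UNIV_nat this] obtain n\<^sub>0 where
    "infinite {n. t n = t n\<^sub>0}"
    by auto
  from infinite_enumerate[OF this] obtain r :: "nat \<Rightarrow> nat" where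
    r: "strict_mono r" "\<And>n. t (r n) = t n\<^sub>0"
    by auto
  let ?\<tau> = "\<lambda>n. \<tau> (r n)"
  have eq: "\<sigma> \<circ> r = (\<lambda>n. gact (t n\<^sub>0) (?\<tau> n))"
    by (rule ext) (simp only: comp_def \<tau>(2) r(2))
  have "(\<lambda>n. gact (t n\<^sub>0) (?\<tau> n)) \<in> cauchy_seqs G3"
    using cauchy_subseq(1)[OF tri_metric_G3 \<sigma>(1) r(1)] by (simp only: eq)
  then have Q: "?\<tau> \<in> cauchy_seqs G3"
    using gact_cauchy_iff[of ?\<tau>] \<tau>(1) by blast
  have "sact (t n\<^sub>0) (Scls G3 ?\<tau>) = Scls G3 (\<sigma> \<circ> r)"
    unfolding eq by (rule sact_Scls[OF Q])
  also have "\<dots> = P"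
    using cauchy_subseq[OF tri_metric_G3 \<sigma>(1) r(1)] \<sigma> Scls_eq_iff[OF tri_metric_G3] by blast
  finally show ?thesis
    using that S3_mem[OF Q] by metis
qed

lemma inj_on_s_iso: "inj_on s_iso (pts (Tens S3))"
proof (rule inj_onI)
  fix p q
  assume "p \<in> pts (Tens S3)" "q \<in> pts (Tens S3)" and eq: "s_iso p = s_iso q"
  then obtain m P n Q where *: "P \<in> pts S3" "Q \<in> pts S3" "p = tens S3 m P" "q = tens S3 n Q"
    by (metis pts_Tens_cases)
  then have "rep_dist S3 (m, P) (n, Q) = 0"
    using eq dst_self[OF tri_metric_S3 sact_mem] by (simp add: sact_def flip: dst_sact)
  then show "p = q"
    using * by (simp add: rep_dist_zero_iff[OF tri_metric_S3])
qed

lemma psi_sact: "P \<in> pts S3 \<Longrightarrow> psi (sact m P) = tens S3 m P"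
  by (simp add: psi_def sact_def inv_into_f_f[OF inj_on_s_iso] tens_mem)

lemma s_iso_psi: "P \<in> pts S3 \<Longrightarrow> s_iso (psi P) = P"
  by (erule sact_cases) (simp add: psi_sact, simp add: sact_def)

text \<open>Distances start at no more than 1 and are halved with each stripped letter, so that of P
  and Q is at most (1/2)^n for every n. The alternative P = Q allows the stripping to stop
  early.\<close>

lemma sact_eqI:
  assumes "R P Q"
    and mem: "\<And>P Q. R P Q \<Longrightarrow> P \<in> pts S3 \<and> Q \<in> pts S3"
    and step: "\<And>P Q. R P Q \<Longrightarrow> P = Q \<or> (\<exists>m P' Q'. P = sact m P' \<and> Q = sact m Q' \<and> R P' Q')"
  shows "P = Q"
proof -
  have "dst S3 P Q \<le> (1/2) ^ n" for n
    using \<open>R P Q\<close>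
  proof (induction n arbitrary: P Q)
    case 0
    then show ?case
      using mem dst_le_1[OF tri_metric_S3] by simp
  next
    case (Suc n)
    from step[OF Suc.prems] show ?case
    proof (elim disjE exE conjE)
      assume "P = Q"
      then show ?thesis
        using mem[OF Suc.prems] by (simp add: dst_self[OF tri_metric_S3])
    next
      fix m P' Q'
      assume "P = sact m P'" "Q = sact m Q'" "R P' Q'"
      then show ?thesis
        using Suc.IH[of P' Q'] mem[of P' Q'] by (simp add: dst_sact rep_dist_same)
    qed
  qed
  moreover have "(\<lambda>n. (1/2 :: real) ^ n) \<longlonglongrightarrow> 0"
    by (rule LIMSEQ_power_zero) simp
  ultimately have "dst S3 P Q \<le> 0"
    by (intro LIMSEQ_le_const) auto
  then show ?thesis
    using mem[OF \<open>R P Q\<close>] dst_nonneg[OF tri_metric_S3, of P Q] dst_zero_iff[OF tri_metric_S3, of P Q] by simp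
qed

section \<open>Limits of the sequences \<open>\<theta>\<^sub>n\<close>\<close>

lemma tw_mem: "x \<in> pts I3 \<Longrightarrow> tw ms x \<in> pts (MI (length ms))"
  using act_mem by (induction ms) (simp_all add: act_def del: MI.simps(2))

lemma theta_mem: "theta m n \<in> pts G3"
  using Gcls_mem[OF tw_mem, of "Pt (corner_of (m n))" "map m [1..<Suc n]"]
  by (simp add: theta_def I3_def del: upt_Suc)

text \<open>At \<open>n = 0\<close> this uses the otherwise irrelevant value \<open>[corner_of (m 0)]\<close> of \<open>theta m 0\<close>.\<close>

lemma theta_Suc: "theta m (Suc n) = gact (m 1) (theta (m \<circ> Suc) n)"
proof -
  have "map m [1..<Suc (Suc n)] = m 1 # map m (map Suc [1..<Suc n])"
    by (subst upt_conv_Cons) (simp_all only: map_Suc_upt, simp_all)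
  then show ?thesis
    using g_iso_tens[OF tw_mem[of "Pt (corner_of (m (Suc n)))" "map (m \<circ> Suc) [1..<Suc n]"], of "m 1"]
    by (simp add: theta_def gact_def act_def I3_def del: upt_Suc)
qed

text \<open>The first \<open>k\<close> letters agree, each halves the distance, and what remains is
  at most 1. The tag sequence varies in the induction because stripping a letter shifts it.\<close>

lemma dst_theta: "k \<le> l \<Longrightarrow> dst G3 (theta m k) (theta m l) \<le> (1/2) ^ k"
proof (induction k arbitrary: l m)
  case 0
  then show ?case
    using dst_le_1[OF tri_metric_G3 theta_mem theta_mem] by simp
next
  case (Suc k)
  then obtain l' where "l = Suc l'" "k \<le> l'"
    by (cases l) auto
  then show ?case
    using Suc.IH[of l' "m \<circ> Suc"] by (simp add: theta_Suc dst_gact theta_mem rep_dist_same comp_def)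
qed

lemma theta_cauchy: "theta m \<in> cauchy_seqs G3"
  unfolding cauchy_seqs_iff[OF tri_metric_G3]
proof (intro conjI allI impI theta_mem)
  fix \<epsilon> :: real
  assume "\<epsilon> > 0"
  then obtain N where N: "(1/2 :: real) ^ N < \<epsilon>"
    using real_arch_pow_inv[of \<epsilon> "1/2"] by auto
  have *: "dst G3 (theta m n) (theta m k) < \<epsilon>" if "n \<ge> N" "n \<le> k" for n k
    using dst_theta[OF that(2), of m] power_decreasing[OF that(1), of "1/2 :: real"] N by linarith
  have "dst G3 (theta m n) (theta m k) < \<epsilon>" if "n \<ge> N" "k \<ge> N" for n k
    using *[of n k] *[of k n] that dst_commute[OF tri_metric_G3 theta_mem theta_mem, of m n m k]
    by (cases "n \<le> k") simp_all
  then show "\<exists>N. \<forall>n\<ge>N. \<forall>k\<ge>N. dst G3 (theta m n) (theta m k) < \<epsilon>"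
    by blast
qed

text \<open>A Cauchy sequence converges in the completion to its own class, and metric limits are
  unique; hence the description in \<open>theta_lim\<close> is proper.\<close>

lemma is_theta_limit_iff: "is_theta_limit m l \<longleftrightarrow> l = Scls G3 (theta m)"
proof -
  have "is_theta_limit m (Scls G3 (theta m))"
    unfolding is_theta_limit_def S3_def by (rule limitin_Scls[OF tri_metric_G3 theta_cauchy])
  then show ?thesis
    using Metric_space.limitin_metric_unique[OF metric_space[OF tri_metric_S3]]
    unfolding is_theta_limit_def by (metis trivial_limit_sequentially)
qed

lemma theta_lim_eq: "theta_lim m = Scls G3 (theta m)"
  by (simp add: theta_lim_def is_theta_limit_iff)

lemma theta_lim_mem: "theta_lim m \<in> pts S3"
  by (simp add: theta_lim_eq S3_mem theta_cauchy)

text \<open>Dropping the initial term of \<open>theta m\<close> leaves the limit unchanged, and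
  every later term begins with the letter \<open>m 1\<close>.\<close>

lemma theta_lim_sact: "theta_lim m = sact (m 1) (theta_lim (m \<circ> Suc))"
proof -
  have eq: "theta m \<circ> Suc = (\<lambda>n. gact (m 1) (theta (m \<circ> Suc) n))"
    by (rule ext) (simp only: comp_apply theta_Suc)
  have "theta_lim m = Scls G3 (theta m \<circ> Suc)"
    using cauchy_subseq[OF tri_metric_G3 theta_cauchy, of Suc m] Scls_eq_iff[OF tri_metric_G3, of "theta m \<circ> Suc" "theta m"]
    by (simp add: theta_lim_eq strict_mono_Suc_iff theta_cauchy)
  also have "\<dots> = sact (m 1) (theta_lim (m \<circ> Suc))"
    unfolding eq theta_lim_eq by (rule sact_Scls[OF theta_cauchy, symmetric])
  finally show ?thesis .
qed

section \<open>Coalgebras\<close>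

lemma unfoldsD:
  assumes "unfolds X e x m y"
  shows "y 1 \<in> pts X" "e x = tens X (m 1) (y 1)" "unfolds X e (y 1) (m \<circ> Suc) (y \<circ> Suc)"
proof -
  have *: "y n \<in> pts X \<and> e (y (n - 1)) = tens X (m n) (y n)" if "n \<ge> 1" for n
    using assms that by (simp add: unfolds_def)
  have "y 0 = x"
    using assms by (simp add: unfolds_def)
  then show "y 1 \<in> pts X" "e x = tens X (m 1) (y 1)"
    using *[of 1] by simp_all
  \<comment> \<open>The condition at n for the shifted sequences is the original one at n + 1; n
    \<ge> 1 ensures that \<open>Suc (n - 1)\<close> is n.\<close>
  have "e ((y \<circ> Suc) (n - 1)) = tens X ((m \<circ> Suc) n) ((y \<circ> Suc) n)" if "n \<ge> 1" for n
    using *[of "Suc n"] that by simp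
  then show "unfolds X e (y 1) (m \<circ> Suc) (y \<circ> Suc)"
    using * by (simp add: unfolds_def)
qed

lemma tip_inj:
  assumes "tri_pointed X" and "tip X m = tip X n"
  shows "m = n"
  using assms by (cases m; cases n) (auto simp: tip_def tri_pointed_def)

text \<open>The point (m, \<open>tip X m\<close>) is glued to nothing: a gluing with copy n would
  force the tips of m and n to agree although m \<noteq> n.\<close>

lemma tens_eq_tipD:
  assumes "tri_pointed X" and "x \<in> pts X" and "tens X n x = tens X m (tip X m)"
  shows "n = m \<and> x = tip X m"
  using tens_eq_cases[OF assms(1,2) tip_mem[OF assms(1)] assms(3)] glue_iff_tip[of X n x m "tip X m"]
    tip_inj[OF assms(1), of m n] by auto

lemma coalgebra3_tip:
  assumes "coalgebra3 X e"
  shows "e (tip X m) = tens X m (tip X m)"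
  using assms by (cases m) (simp_all add: coalgebra3_def morphism3_def Tens_def tip_def)

lemma theta_lim_tip:
  assumes e: "coalgebra3 X e" and "unfolds X e (tip X t) m y"
  shows "theta_lim m = tip S3 t"
proof -
  \<comment> \<open>The tag \<open>t\<close> is fixed while the unfolding varies, because after the
    forced letter \<open>t\<close> the rest is another unfolding of the same tip.\<close>
  define R where "R P Q \<longleftrightarrow> Q = tip S3 t \<and> (\<exists>m y. unfolds X e (tip X t) m y \<and> P = theta_lim m)" for P Q
  show ?thesis
  proof (rule sact_eqI[where R = R])
    show "R (theta_lim m) (tip S3 t)"
      using assms(2) by (auto simp: R_def)
    fix P Q
    assume "R P Q"
    then obtain m y where *: "unfolds X e (tip X t) m y" "P = theta_lim m" "Q = tip S3 t"
      by (auto simp: R_def)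
    then show "P \<in> pts S3 \<and> Q \<in> pts S3"
      by (simp add: theta_lim_mem tip_mem tri_metric_pointed tri_metric_S3)
    have "tri_pointed X"
      using e by (simp add: coalgebra3_def)
    then have "m 1 = t" "y 1 = tip X t"
      using tens_eq_tipD[OF _ unfoldsD(1)[OF *(1)], of "m 1" t] unfoldsD(2)[OF *(1)] coalgebra3_tip[OF e, of t] by auto
    then have "P = sact t (theta_lim (m \<circ> Suc))" "Q = sact t (tip S3 t)" "R (theta_lim (m \<circ> Suc)) (tip S3 t)"
      using * theta_lim_sact[of m] unfoldsD(3)[OF *(1)] by (auto simp: R_def sact_tip)
    then show "P = Q \<or> (\<exists>m P' Q'. P = sact m P' \<and> Q = sact m Q' \<and> R P' Q')"
      by blast
  qed
qed

lemma theta_lim_unique: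
  assumes e: "coalgebra3 X e" and "unfolds X e x m y" and "unfolds X e x m' y'"
  shows "theta_lim m = theta_lim m'"
proof -
  define R where "R P Q \<longleftrightarrow> (\<exists>x m y m' y'. unfolds X e x m y \<and> unfolds X e x m' y' \<and>
    P = theta_lim m \<and> Q = theta_lim m')" for P Q
  show ?thesis
  proof (rule sact_eqI[where R = R])
    show "R (theta_lim m) (theta_lim m')"
      using assms(2,3) by (auto simp: R_def)
    fix P Q
    assume "R P Q"
    then obtain x m y m' y' where *: "unfolds X e x m y" "unfolds X e x m' y'" "P = theta_lim m" "Q = theta_lim m'"
      by (auto simp: R_def)
    then show "P \<in> pts S3 \<and> Q \<in> pts S3"
      by (simp add: theta_lim_mem)
    have X: "tri_pointed X"
      using e by (simp add: coalgebra3_def)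
    have PQ: "P = sact (m 1) (theta_lim (m \<circ> Suc))" "Q = sact (m' 1) (theta_lim (m' \<circ> Suc))"
      using *(3,4) theta_lim_sact by blast+
    note u = unfoldsD[OF *(1)] and u' = unfoldsD[OF *(2)]
    have "tens X (m 1) (y 1) = tens X (m' 1) (y' 1)"
      using u(2) u'(2) by simp
    then consider "m 1 = m' 1" "y 1 = y' 1"
      | "m 1 \<noteq> m' 1" "y 1 = tip X (m' 1)" "y' 1 = tip X (m 1)"
      using tens_eq_cases[OF X u(1) u'(1)] glue_iff_tip by metis
    then show "P = Q \<or> (\<exists>m P' Q'. P = sact m P' \<and> Q = sact m Q' \<and> R P' Q')"
    proof cases
      case 1
      have "R (theta_lim (m \<circ> Suc)) (theta_lim (m' \<circ> Suc))"
        unfolding R_def using u(3) u'(3) 1(2) by metis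
      then show ?thesis
        using PQ 1(1) by metis
    next
      case 2
      \<comment> \<open>Both remainders unfold distinguished points, so their limits are the
        corresponding tips of S. The two pairs are therefore glued in M \<otimes> S and have one
        image under s.\<close>
      have "P = sact (m 1) (tip S3 (m' 1))" "Q = sact (m' 1) (tip S3 (m 1))"
        using PQ theta_lim_tip[OF e] u(3) u'(3) 2(2,3) by metis+
      moreover have "tens S3 (m 1) (tip S3 (m' 1)) = tens S3 (m' 1) (tip S3 (m 1))"
        using tens_glue[OF tri_metric_pointed[OF tri_metric_S3]] glue_iff_tip[of S3 "m 1" "tip S3 (m' 1)" "m' 1" "tip S3 (m 1)"]
          2(1) by metis
      ultimately show ?thesis
        by (simp add: sact_def)
    qed
  qed
qed

text \<open>The coalgebra equation says that \<psi>(h x) is k \<otimes> h x'; applying s to both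
  sides gives a form to which \<open>sact_eqI\<close> applies.\<close>

lemma coalgebra_morphism_sact:
  assumes X: "tri_pointed X" and h: "morphism3 X S3 h" and "Tens_map S3 h (e x) = psi (h x)"
    and "x \<in> pts X" and "x' \<in> pts X" and "e x = tens X k x'"
  shows "h x = sact k (h x')"
proof -
  have "psi (h x) = tens S3 k (h x')"
    using assms Tens_map_tens[OF X tri_metric_pointed[OF tri_metric_S3] h \<open>x' \<in> pts X\<close>, of k] by simp
  moreover have "h x \<in> pts S3"
    using h \<open>x \<in> pts X\<close> by (auto simp: morphism3_def)
  ultimately show ?thesis
    using s_iso_psi[of "h x"] by (simp add: sact_def)
qed

theorem proposition1:
  fixes X :: "'a tri"
    and e :: "'a \<Rightarrow> (tag \<times> 'a) set"
    and m :: "'a \<Rightarrow> nat \<Rightarrow> tag"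
    and y :: "'a \<Rightarrow> nat \<Rightarrow> 'a"
    and f :: "'a \<Rightarrow> (nat \<Rightarrow> (nat \<times> gterm) set) set"
  assumes "coalgebra3 X e"
    and "\<And>x. x \<in> pts X \<Longrightarrow> unfolds X e x (m x) (y x)"
    and "\<And>x. x \<in> pts X \<Longrightarrow> f x = theta_lim (m x)"
  shows "(\<forall>x\<in>pts X. \<exists>!l. is_theta_limit (m x) l) \<and>
    morphism3 X S3 f \<and>
    (\<forall>x\<in>pts X. Tens_map S3 f (e x) = psi (f x)) \<and>
    (\<forall>h. morphism3 X S3 h \<and> (\<forall>x\<in>pts X. Tens_map S3 h (e x) = psi (h x)) \<longrightarrow>
         (\<forall>x\<in>pts X. h x = f x))"
proof -
  have X: "tri_pointed X"
    using assms(1) by (simp add: coalgebra3_def)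
  note unf = unfoldsD[OF assms(2)]
  have f_tip: "f (tip X t) = tip S3 t" for t
    using theta_lim_tip[OF assms(1) assms(2)[OF tip_mem[OF X]], of t] assms(3)[OF tip_mem[OF X]] by simp
  have f: "morphism3 X S3 f"
    by (rule morphism3_tipI) (auto simp: f_tip assms(3) theta_lim_mem)
  have f_eq: "Tens_map S3 f (e x) = psi (f x)" if x: "x \<in> pts X" for x
  proof -
    \<comment> \<open>The unfolding chosen for \<open>y x 1\<close> may differ from the tail of the
      one chosen for \<open>x\<close>; independence of the choice bridges the two.\<close>
    have "f (y x 1) = theta_lim (m x \<circ> Suc)"
      using theta_lim_unique[OF assms(1) assms(2)[OF unf(1)[OF x]] unf(3)[OF x]] assms(3)[OF unf(1)[OF x]]
      by simp
    then have "f x = sact (m x 1) (f (y x 1))"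
      using assms(3)[OF x] theta_lim_sact[of "m x"] by simp
    moreover have "f (y x 1) \<in> pts S3"
      using f unf(1)[OF x] by (auto simp: morphism3_def)
    ultimately have "psi (f x) = tens S3 (m x 1) (f (y x 1))"
      by (simp add: psi_sact)
    then show ?thesis
      using Tens_map_tens[OF X tri_metric_pointed[OF tri_metric_S3] f unf(1)[OF x], of "m x 1"] unf(2)[OF x]
      by simp
  qed
  have unique: "h x = f x"
    if h: "morphism3 X S3 h" "\<forall>x\<in>pts X. Tens_map S3 h (e x) = psi (h x)" and x: "x \<in> pts X" for h x
  proof -
    \<comment> \<open>Both morphisms satisfy the same equation at z, so both values strip the letter
      \<open>m z 1\<close> and leave the values at \<open>y z 1\<close>.\<close>
    define R where "R P Q \<longleftrightarrow> (\<exists>x\<in>pts X. P = h x \<and> Q = f x)" for P Q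
    show ?thesis
    proof (rule sact_eqI[where R = R])
      show "R (h x) (f x)"
        using x by (auto simp: R_def)
      fix P Q
      assume "R P Q"
      then obtain z where z: "z \<in> pts X" "P = h z" "Q = f z"
        by (auto simp: R_def)
      then show "P \<in> pts S3 \<and> Q \<in> pts S3"
        using f h(1) by (auto simp: morphism3_def)
      have "P = sact (m z 1) (h (y z 1))"
        unfolding z(2)
        by (rule coalgebra_morphism_sact[where e = e])
          (use X h z(1) unf(1,2)[OF z(1)] in blast)+
      moreover have "Q = sact (m z 1) (f (y z 1))"
        unfolding z(3)
        by (rule coalgebra_morphism_sact[where e = e])
          (use X f f_eq z(1) unf(1,2)[OF z(1)] in blast)+
      moreover have "R (h (y z 1)) (f (y z 1))"
        using unf(1)[OF z(1)] by (auto simp: R_def)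
      ultimately show "P = Q \<or> (\<exists>m P' Q'. P = sact m P' \<and> Q = sact m Q' \<and> R P' Q')"
        by blast
    qed
  qed
  show ?thesis
    using f f_eq unique unfolding is_theta_limit_iff by blast
qed

end
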